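(* Let $\tilde{\mathcal G}=(\tilde V,\tilde E)$ be a finite, undirected, connected graph without self-loops, with reference vertex $\delta\in\tilde V$, $V=\tilde V\setminus\{\delta\}$, and positive symmetric edge weights $W$. Let $\mu^W$ be the associated $H^{2|2}$ probability measure. For all $\theta\in(-\infty,0]^{\tilde V}$ and all $\lambda\in\Lambda_V$ one has $$\mathbb{E}_{\mu^W}\left[e^{\langle\theta, e^u_{\tilde V}\rangle-\frac12\langle\theta,\hat G(u)\theta\rangle}\,e^{-\langle\lambda_V,\beta(u)\rangle}\right]=\mathcal{L}^W(\lambda)\, e^{\langle\theta,\sqrt{1+\lambda}\rangle},$$ where $$\mathcal{L}^W(\lambda)=\prod_{(i\sim j)\in\tilde E}e^{W_{ij}\left(1-\sqrt{1+\lambda_i}\sqrt{1+\lambda_j}\right)}\prod_{i\in V}\frac{1}{\sqrt{1+\lambda_i}}.$$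
   Context: Weights: $W_{ij}=W_{ji}>0$ for every undirected edge $(i\sim j)\in\tilde E$ and $W_{ij}=0$ if $i\not\sim j$ (in particular $W_{ii}=0$). Products over $(i\sim j)\in\tilde E$ run over undirected edges, each counted once. $U_V=\{u\in\mathbb{R}^{\tilde V}: u_\delta=0\}$, and $\Omega_V=U_V\times U_V$ with elements $(u,s)$, $u_\delta=s_\delta=0$. For $u\in U_V$ the matrix $A^W(u)\in\mathbb{R}^{\tilde V\times\tilde V}$ has entries $A^W_{ij}(u)=-W_{ij}e^{u_i+u_j}$ for $i\ne j$ and $A^W_{ii}(u)=\sum_{k\in\tilde V}W_{ik}e^{u_i+u_k}$. $A^W_{VV}(u)$ is the submatrix obtained by deleting row and column $\delta$ (it is positive definite). The $H^{2|2}$ measure is the probability measure on $\Omega_V$ $$\mu^W(du\,ds)=e^{-\frac12 s^tA^W(u)s}\,\det A^W_{VV}(u)\prod_{(i\sim j)\in\tilde E}e^{-W_{ij}[\cosh(u_i-u_j)-1]}\prod_{i\in V}e^{-u_i}\frac{du_i\,ds_i}{2\pi},$$ with $du_i,ds_i$ Lebesgue measure on $\mathbb{R}$. (It is known that this has total mass 1.) Green's function: $\hat G(u)\in\mathbb{R}^{\tilde V\times\tilde V}$, $\hat G_{ij}(u)=e^{u_i}(A^W_{VV}(u)^{-1})_{ij}e^{u_j}$ for $i,j\in V$, and $\hat G_{ij}(u)=0$ if $i=\delta$ or $j=\delta$. $\beta(u)=(\beta_i(u))_{i\in V}$ with $\beta_i(u)=\frac12\sum_{j\in\tilde V:\,j\sim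 i}W_{ij}e^{u_j-u_i}$. $\Lambda_V=\{\lambda\in(-1,\infty)^{\tilde V}:\lambda_\delta=0\}$; $\lambda_V$ is the restriction of $\lambda$ to $V$; $\sqrt{1+\lambda}=(\sqrt{1+\lambda_i})_{i\in\tilde V}$; $e^u_{\tilde V}=(e^{u_i})_{i\in\tilde V}$; $\langle a,b\rangle=\sum_i a_ib_i$ is the euclidean scalar product (over $V$ or $\tilde V$ according to the vectors). *)

theory Defs
  imports "HOL-Analysis.Analysis"
begin

text \<open>
  Throughout, \<open>Vt\<close> is the full vertex set (including the reference vertex \<open>\<delta>\<close>) and
  \<open>V = Vt - {\<delta>}\<close>.  Vectors and matrices indexed by a finite set \<open>I\<close> of vertices are functions
  of which only the values on \<open>I\<close> matter; points of the integration space are in addition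
  extensional.
\<close>

section \<open>Vectors and matrices indexed by a finite set\<close>

definition inner_on :: "'v set \<Rightarrow> ('v \<Rightarrow> real) \<Rightarrow> ('v \<Rightarrow> real) \<Rightarrow> real" where
  "inner_on I a b = (\<Sum>i\<in>I. a i * b i)"

definition mult_vec_on :: "'v set \<Rightarrow> ('v \<Rightarrow> 'v \<Rightarrow> real) \<Rightarrow> ('v \<Rightarrow> real) \<Rightarrow> ('v \<Rightarrow> real)" where
  "mult_vec_on I M v = (\<lambda>i. \<Sum>j\<in>I. M i j * v j)"

text \<open>
  The library's \<^const>\<open>det\<close> and \<^const>\<open>matrix_inv\<close> are for matrices indexed by a type.  Deleting
  the row and column of \<open>\<delta>\<close> changes the index set, so the same definitions are used relative to
  an index set; \<open>det_on V A\<close> and \<open>inv_on V A\<close> are then the determinant and the inverse of the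
  submatrix of \<open>A\<close> with rows and columns in \<open>V\<close>.
\<close>

definition det_on :: "'v set \<Rightarrow> ('v \<Rightarrow> 'v \<Rightarrow> real) \<Rightarrow> real" where
  "det_on I M = (\<Sum>p | p permutes I. of_int (sign p) * (\<Prod>i\<in>I. M i (p i)))"

lemma det_on_UNIV: "det_on UNIV (\<lambda>i j. M $ i $ j) = det M"
  by (simp add: det_on_def det_def)

definition is_inverse_on ::
    "'v set \<Rightarrow> ('v \<Rightarrow> 'v \<Rightarrow> real) \<Rightarrow> ('v \<Rightarrow> 'v \<Rightarrow> real) \<Rightarrow> bool" where
  "is_inverse_on I M N \<longleftrightarrow>
     (\<forall>i\<in>I. \<forall>j\<in>I. (\<Sum>k\<in>I. M i k * N k j) = (if i = j then 1 else 0)) \<and>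
     (\<forall>i\<in>I. \<forall>j\<in>I. (\<Sum>k\<in>I. N i k * M k j) = (if i = j then 1 else 0))"

definition inv_on :: "'v set \<Rightarrow> ('v \<Rightarrow> 'v \<Rightarrow> real) \<Rightarrow> ('v \<Rightarrow> 'v \<Rightarrow> real)" where
  "inv_on I M = (SOME N. is_inverse_on I M N)"

lemma inv_on_unique:
  assumes "finite I" "is_inverse_on I M N" "i \<in> I" "j \<in> I"
  shows "inv_on I M i j = N i j"
proof -
  define N' where "N' = inv_on I M"
  have N': "is_inverse_on I M N'"
    unfolding N'_def inv_on_def by (rule someI[of "is_inverse_on I M", OF assms(2)])
  have "N' i j = (\<Sum>k\<in>I. N' i k * (if k = j then 1 else 0))"
    using assms by (simp add: if_distrib cong: if_cong)
  also have "\<dots> = (\<Sum>k\<in>I. N' i k * (\<Sum>l\<in>I. M k l * N l j))"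
    using assms by (intro sum.cong) (auto simp: is_inverse_on_def)
  also have "\<dots> = (\<Sum>l\<in>I. (\<Sum>k\<in>I. N' i k * M k l) * N l j)"
    by (simp add: sum_distrib_left sum_distrib_right mult.assoc) (rule sum.swap)
  also have "\<dots> = (\<Sum>l\<in>I. (if i = l then 1 else 0) * N l j)"
    using N' assms by (intro sum.cong) (auto simp: is_inverse_on_def)
  also have "\<dots> = N i j"
    using assms by (simp add: if_distrib[of "\<lambda>x. x * _"] cong: if_cong)
  finally show ?thesis by (simp add: N'_def)
qed

section \<open>Weighted graphs\<close>

text \<open>Edges are unordered pairs \<open>{i, j}\<close> of distinct vertices.\<close>

definition simple_graph :: "'v set \<Rightarrow> 'v set set \<Rightarrow> bool" where
  "simple_graph Vt E \<longleftrightarrow> finite Vt \<and> E \<subseteq> {{i, j} | i j. i \<in> Vt \<and> j \<in> Vt \<and> i \<noteq> j}"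

definition connected_graph :: "'v set \<Rightarrow> 'v set set \<Rightarrow> bool" where
  "connected_graph Vt E \<longleftrightarrow> (\<forall>i\<in>Vt. \<forall>j\<in>Vt. (i, j) \<in> {(a, b). {a, b} \<in> E}\<^sup>*)"

definition edge_weights :: "'v set \<Rightarrow> 'v set set \<Rightarrow> ('v \<Rightarrow> 'v \<Rightarrow> real) \<Rightarrow> bool" where
  "edge_weights Vt E W \<longleftrightarrow>
     (\<forall>i\<in>Vt. \<forall>j\<in>Vt. W i j = W j i \<and> (if {i, j} \<in> E then W i j > 0 else W i j = 0))"

text \<open>The common value \<open>f i j = f j i\<close> of a symmetric function on the unordered pair \<open>{i, j}\<close>.\<close>

definition on_edge :: "('v \<Rightarrow> 'v \<Rightarrow> real) \<Rightarrow> 'v set \<Rightarrow> real" where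
  "on_edge f e = the_elem {f i j | i j. e = {i, j}}"

lemma on_edge_eq:
  assumes "f i j = f j i"
  shows "on_edge f {i, j} = f i j"
proof -
  have "{f a b | a b. {i, j} = {a, b}} = {f i j}"
    using assms by (auto simp: doubleton_eq_iff)
  then show ?thesis by (simp add: on_edge_def)
qed

section \<open>The $H^{2|2}$ measure\<close>

definition A_mat :: "'v set \<Rightarrow> ('v \<Rightarrow> 'v \<Rightarrow> real) \<Rightarrow> ('v \<Rightarrow> real) \<Rightarrow> 'v \<Rightarrow> 'v \<Rightarrow> real" where
  "A_mat Vt W u i j =
     (if i = j then \<Sum>k\<in>Vt. W i k * exp (u i + u k) else - W i j * exp (u i + u j))"

definition U_space :: "'v set \<Rightarrow> 'v \<Rightarrow> ('v \<Rightarrow> real) set" where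
  "U_space Vt \<delta> = {u \<in> Vt \<rightarrow>\<^sub>E UNIV. u \<delta> = 0}"

text \<open>Lebesgue measure in the coordinates \<open>u i\<close>, \<open>i \<in> V\<close>, carried over to \<open>U_space\<close> by setting
  the coordinate of \<open>\<delta>\<close> to 0.\<close>

definition lebesgue_U :: "'v set \<Rightarrow> 'v \<Rightarrow> ('v \<Rightarrow> real) measure" where
  "lebesgue_U Vt \<delta> =
     distr (Pi\<^sub>M (Vt - {\<delta>}) (\<lambda>_. lborel))
           (restrict_space (Pi\<^sub>M Vt (\<lambda>_. borel)) (U_space Vt \<delta>))
           (\<lambda>u. u(\<delta> := 0))"

definition H22_density ::
    "'v set \<Rightarrow> 'v set set \<Rightarrow> ('v \<Rightarrow> 'v \<Rightarrow> real) \<Rightarrow> 'v \<Rightarrow> ('v \<Rightarrow> real) \<Rightarrow> ('v \<Rightarrow> real) \<Rightarrow> real" where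
  "H22_density Vt E W \<delta> u s =
     exp (- (1/2) * inner_on Vt s (mult_vec_on Vt (A_mat Vt W u) s)) *
     det_on (Vt - {\<delta>}) (A_mat Vt W u) *
     (\<Prod>e\<in>E. on_edge (\<lambda>i j. exp (- W i j * (cosh (u i - u j) - 1))) e) *
     (\<Prod>i\<in>Vt - {\<delta>}. exp (- u i) / (2 * pi))"

text \<open>For a connected graph with positive weights the submatrix of \<open>A_mat\<close> on \<open>V\<close> is positive
  definite, so the density is positive and \<^const>\<open>ennreal\<close> does not truncate it.\<close>

definition H22_measure ::
    "'v set \<Rightarrow> 'v set set \<Rightarrow> ('v \<Rightarrow> 'v \<Rightarrow> real) \<Rightarrow> 'v \<Rightarrow> (('v \<Rightarrow> real) \<times> ('v \<Rightarrow> real)) measure" where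
  "H22_measure Vt E W \<delta> =
     density (lebesgue_U Vt \<delta> \<Otimes>\<^sub>M lebesgue_U Vt \<delta>)
       (\<lambda>(u, s). ennreal (H22_density Vt E W \<delta> u s))"

definition green :: "'v set \<Rightarrow> ('v \<Rightarrow> 'v \<Rightarrow> real) \<Rightarrow> 'v \<Rightarrow> ('v \<Rightarrow> real) \<Rightarrow> 'v \<Rightarrow> 'v \<Rightarrow> real" where
  "green Vt W \<delta> u i j =
     (if i = \<delta> \<or> j = \<delta> then 0
      else exp (u i) * inv_on (Vt - {\<delta>}) (A_mat Vt W u) i j * exp (u j))"

definition beta ::
    "'v set \<Rightarrow> 'v set set \<Rightarrow> ('v \<Rightarrow> 'v \<Rightarrow> real) \<Rightarrow> ('v \<Rightarrow> real) \<Rightarrow> 'v \<Rightarrow> real" where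
  "beta Vt E W u i = 1/2 * (\<Sum>j | j \<in> Vt \<and> {i, j} \<in> E. W i j * exp (u j - u i))"

definition Lambda_set :: "'v set \<Rightarrow> 'v \<Rightarrow> ('v \<Rightarrow> real) set" where
  "Lambda_set Vt \<delta> = {l. (\<forall>i\<in>Vt. l i > -1) \<and> l \<delta> = 0}"

definition L_fun ::
    "'v set \<Rightarrow> 'v set set \<Rightarrow> ('v \<Rightarrow> 'v \<Rightarrow> real) \<Rightarrow> 'v \<Rightarrow> ('v \<Rightarrow> real) \<Rightarrow> real" where
  "L_fun Vt E W \<delta> l =
     (\<Prod>e\<in>E. on_edge (\<lambda>i j. exp (W i j * (1 - sqrt (1 + l i) * sqrt (1 + l j)))) e) *
     (\<Prod>i\<in>Vt - {\<delta>}. 1 / sqrt (1 + l i))"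

end

theory Submission
  imports Defs "HOL-Probability.Distributions"
begin

text \<open>
  Three observations reduce the theorem to an induction with one-dimensional integrals.

  (1) The density is Gaussian in \<open>s\<close>, so integrating out \<open>s\<close> only replaces the determinant of \<open>A\<close> by
  a constant times its square root.  With \<open>H = diag (2 \<beta>(u)) - W\<close> on \<open>V\<close> one has \<open>A = e\<^sup>u H e\<^sup>u\<close>, so that the Green's function
  is \<open>H\<^sup>-\<^sup>1\<close>.

  (2) If \<open>\<omega>\<close> denotes the weights to \<open>\<delta>\<close>, then \<open>H e\<^sup>u = \<omega>\<close> by the definition of \<open>\<beta>\<close>.  Hence, up to constants, everything
  in the exponent apart from a combination of the \<open>\<beta>\<^sub>i\<close> with \<open>i \<in> V\<close> is the single quadratic form
  \<open>- z\<^sup>t H\<^sup>-\<^sup>1 z / 2\<close> with \<open>z = \<omega> - \<theta>\<close> (lemma \<open>green_form\<close>).  Writing \<open>\<alpha>\<^sub>i = sqrt (1 + \<lambda>\<^sub>i)\<close>,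
  it remains to integrate \<open>sqrt (det H) exp (- \<Sum> \<alpha>\<^sub>i\<^sup>2 \<beta>\<^sub>i - z\<^sup>t H\<^sup>-\<^sup>1 z / 2)\<close> over \<open>u\<close>.

  (3) Eliminating a vertex \<open>a\<close> from \<open>H\<close> by a Gaussian step with pivot \<open>t\<close> gives an operator of the same kind, for
  the graph without \<open>a\<close> with weights \<open>W\<^sub>i\<^sub>j + W\<^sub>i\<^sub>a W\<^sub>a\<^sub>j / t\<close> and with \<open>\<omega>\<close> and \<open>z\<close> modified accordingly (lemma \<open>schroedinger_elim\<close>).
  When the other coordinates are fixed, \<open>ln t\<close> is a constant minus \<open>u\<^sub>a\<close>.  So one may
  integrate over \<open>ln t\<close> instead of \<open>u\<^sub>a\<close>, and, after exchanging the integrals, use the induction hypothesis for fixed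
  \<open>t\<close>.  What is left is \<open>\<integral> exp (- (\<alpha>\<^sub>a\<^sup>2 t + c\<^sup>2 / t) / 2) t\<^sup>-\<^sup>1\<^sup>/\<^sup>2 dt = sqrt (2 \<pi>) / \<alpha>\<^sub>a * exp (- \<alpha>\<^sub>a c)\<close> with
  \<open>c = z\<^sub>a + \<Sum> \<alpha>\<^sub>i W\<^sub>i\<^sub>a\<close> (lemma \<open>nn_integral_half_bessel\<close>), which gives lemma \<open>nn_integral_reduced_density\<close>.

  All integrands are nonnegative, so that Tonelli's theorem applies throughout and integrability comes with
  the value.  In particular, that \<open>\<mu>\<^sup>W\<close> has total mass \<open>1\<close> is the case \<open>\<theta> = 0\<close>, \<open>\<lambda> = 0\<close>.
\<close>

section \<open>Pivots of Gaussian elimination\<close>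

text \<open>Composition with the transposition of the two rows is a sign-reversing bijection of the permutations
  which leaves the products unchanged.\<close>

lemma det_on_identical_rows:
  assumes "finite I" "a \<in> I" "b \<in> I" "a \<noteq> b" and eq: "\<And>j. j \<in> I \<Longrightarrow> M a j = M b j"
  shows "det_on I M = 0"
proof -
  let ?t = "Transposition.transpose a b"
  let ?P = "{p. p permutes I}"
  have t: "?t permutes I"
    using assms by (intro permutes_swap_id) auto
  have "det_on I M = (\<Sum>p\<in>?P. of_int (sign (p \<circ> ?t)) * (\<Prod>i\<in>I. M i ((p \<circ> ?t) i)))"
    unfolding det_on_def using sum_permutations_compose_right[OF t] by blast
  also have "\<dots> = (\<Sum>p\<in>?P. - (of_int (sign p) * (\<Prod>i\<in>I. M i (p i))))"
  proof (rule sum.cong[OF refl])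
    fix p assume "p \<in> ?P"
    then have p: "p permutes I" by simp
    have sgn: "sign (p \<circ> ?t) = - sign p"
      using sign_compose[OF permutes_imp_permutation[OF assms(1) p] permutation_swap_id] assms(4)
      by (simp add: sign_swap_id)
    have "(\<Prod>i\<in>I. M i ((p \<circ> ?t) i)) = (\<Prod>i\<in>I. M (?t i) (p i))"
      using prod.permute[OF t, of "\<lambda>i. M i ((p \<circ> ?t) i)"] by (simp add: o_def)
    also have "\<dots> = (\<Prod>i\<in>I. M i (p i))"
    proof (rule prod.cong[OF refl])
      fix i assume "i \<in> I"
      then have "p i \<in> I" using p by (simp add: permutes_in_image)
      then show "M (?t i) (p i) = M i (p i)"
        using eq[of "p i"] by (auto simp: Transposition.transpose_def)
    qed
    finally show "of_int (sign (p \<circ> ?t)) * (\<Prod>i\<in>I. M i ((p \<circ> ?t) i))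
        = - (of_int (sign p) * (\<Prod>i\<in>I. M i (p i)))"
      by (simp add: sgn)
  qed
  also have "\<dots> = - det_on I M"
    by (simp add: det_on_def sum_negf)
  finally show ?thesis by simp
qed

lemma det_on_cong:
  assumes "\<And>i j. i \<in> I \<Longrightarrow> j \<in> I \<Longrightarrow> M i j = N i j"
  shows "det_on I M = det_on I N"
  unfolding det_on_def using assms
  by (intro sum.cong refl arg_cong2[where f="(*)"] prod.cong) (auto simp: permutes_in_image)

lemma det_on_row_add:
  assumes "finite I" "a \<in> I" "k \<in> I" "k \<noteq> a"
  shows "det_on I (\<lambda>i j. if i = k then M i j + c * M a j else M i j) = det_on I M"
proof -
  let ?N = "\<lambda>i j. if i = k then M a j else M i j"
  have "det_on I (\<lambda>i j. if i = k then M i j + c * M a j else M i j) = det_on I M + c * det_on I ?N"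
    unfolding det_on_def sum_distrib_left sum.distrib[symmetric]
  proof (rule sum.cong[OF refl])
    fix p
    have split: "(\<Prod>i\<in>I. F i) = F k * (\<Prod>i\<in>I - {k}. F i)" for F :: "'a \<Rightarrow> real"
      using assms(1,3) by (rule prod.remove)
    show "of_int (sign p) * (\<Prod>i\<in>I. if i = k then M i (p i) + c * M a (p i) else M i (p i))
      = of_int (sign p) * (\<Prod>i\<in>I. M i (p i)) + c * (of_int (sign p) * (\<Prod>i\<in>I. ?N i (p i)))"
      by (simp add: split algebra_simps)
  qed
  also have "det_on I ?N = 0"
    using assms by (intro det_on_identical_rows[of I a k]) auto
  finally show ?thesis by simp
qed

text \<open>One step of Gaussian elimination with pivot \<open>M a a\<close>: the Schur complement of the entry \<open>(a, a)\<close>.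
  Row and column \<open>a\<close> of the result vanish and are ignored from then on.\<close>

definition schur :: "'v \<Rightarrow> ('v \<Rightarrow> 'v \<Rightarrow> real) \<Rightarrow> 'v \<Rightarrow> 'v \<Rightarrow> real" where
  "schur a M = (\<lambda>i j. M i j - M i a * M a j / M a a)"

text \<open>Adding multiples of row \<open>a\<close> to the other rows clears column \<open>a\<close> below the pivot, after which only
  permutations fixing \<open>a\<close> contribute to the determinant.\<close>

lemma det_on_schur:
  assumes fin: "finite V" and a: "a \<notin> V" and nz: "M a a \<noteq> 0"
  shows "det_on (insert a V) M = M a a * det_on V (schur a M)"
proof -
  let ?R = "\<lambda>S i j. if i \<in> S then schur a M i j else M i j"
  have elim: "det_on (insert a V) (?R S) = det_on (insert a V) M" if "S \<subseteq> V" for S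
    using finite_subset[OF that fin] that
  proof (induction S rule: finite_induct)
    case (insert k S)
    have "?R (insert k S) = (\<lambda>i j. if i = k then ?R S i j + (- M k a / M a a) * ?R S a j else ?R S i j)"
      using insert a by (auto simp: fun_eq_iff schur_def)
    then show ?case
      using insert a fin det_on_row_add[of "insert a V" a k "?R S" "- M k a / M a a"] by auto
  qed simp
  let ?N = "?R V"
  have col: "?N i a = 0" if "i \<in> V" for i
    using that nz by (simp add: schur_def)
  have "det_on (insert a V) ?N = (\<Sum>p | p permutes V. of_int (sign p) * (\<Prod>i\<in>insert a V. ?N i (p i)))"
    unfolding det_on_def
  proof (rule sum.mono_neutral_right)
    show "finite {p. p permutes insert a V}"
      using fin by (simp add: finite_permutations)
    show "{p. p permutes V} \<subseteq> {p. p permutes insert a V}"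
      by (auto intro: permutes_subset)
    show "\<forall>p\<in>{p. p permutes insert a V} - {p. p permutes V}.
        of_int (sign p) * (\<Prod>i\<in>insert a V. ?N i (p i)) = 0"
    proof
      fix p assume p: "p \<in> {p. p permutes insert a V} - {p. p permutes V}"
      \<comment> \<open>such a \<open>p\<close> moves \<open>a\<close>, hence some row other than \<open>a\<close> contributes its entry in column \<open>a\<close>\<close>
      have "p a \<noteq> a"
        using p permutes_superset[of p "insert a V" V] by auto
      moreover obtain i where i: "i \<in> insert a V" "p i = a"
        using p permutes_image[of p "insert a V"] by (metis DiffD1 imageE insertI1 mem_Collect_eq)
      ultimately have "i \<in> V" by auto
      then have "?N i (p i) = 0" using col i by simp
      then show "of_int (sign p) * (\<Prod>i\<in>insert a V. ?N i (p i)) = 0"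
        using i fin prod_zero[of "insert a V" "\<lambda>i. ?N i (p i)"] by auto
    qed
  qed
  also have "\<dots> = (\<Sum>p | p permutes V. M a a * (of_int (sign p) * (\<Prod>i\<in>V. schur a M i (p i))))"
  proof (rule sum.cong[OF refl])
    fix p assume "p \<in> {p. p permutes V}"
    then have "p a = a" using a by (simp add: permutes_not_in)
    then show "of_int (sign p) * (\<Prod>i\<in>insert a V. ?N i (p i))
        = M a a * (of_int (sign p) * (\<Prod>i\<in>V. schur a M i (p i)))"
      using fin a by simp
  qed
  also have "\<dots> = M a a * det_on V (schur a M)"
    by (simp add: det_on_def sum_distrib_left)
  finally show ?thesis
    using elim[of V] by simp
qed

text \<open>A list fixes the order in which indices are eliminated.  The determinant, the positive definiteness and
  the quadratic form \<open>z\<^sup>t M\<^sup>-\<^sup>1 z\<close> of a symmetric matrix are all read off from the pivots met on the way.  In this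
  form they are measurable functions of the entries by construction, and each of them follows the
  vertex-by-vertex recursion on which the integration below rests.\<close>

primrec pivots_pos :: "'v list \<Rightarrow> ('v \<Rightarrow> 'v \<Rightarrow> real) \<Rightarrow> bool" where
  "pivots_pos [] M \<longleftrightarrow> True"
| "pivots_pos (a # xs) M \<longleftrightarrow> M a a > 0 \<and> pivots_pos xs (schur a M)"

primrec pivot_prod :: "'v list \<Rightarrow> ('v \<Rightarrow> 'v \<Rightarrow> real) \<Rightarrow> real" where
  "pivot_prod [] M = 1"
| "pivot_prod (a # xs) M = M a a * pivot_prod xs (schur a M)"

definition eliminate :: "'v \<Rightarrow> ('v \<Rightarrow> 'v \<Rightarrow> real) \<Rightarrow> ('v \<Rightarrow> real) \<Rightarrow> 'v \<Rightarrow> real" where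
  "eliminate a M z = (\<lambda>i. z i - M i a * z a / M a a)"

text \<open>The form \<open>z\<^sup>t M\<^sup>-\<^sup>1 z\<close>: the same row operations are applied to the right hand side of \<open>M x = z\<close>.\<close>

primrec pivot_form :: "'v list \<Rightarrow> ('v \<Rightarrow> 'v \<Rightarrow> real) \<Rightarrow> ('v \<Rightarrow> real) \<Rightarrow> real" where
  "pivot_form [] M z = 0"
| "pivot_form (a # xs) M z = (z a)\<^sup>2 / M a a + pivot_form xs (schur a M) (eliminate a M z)"

lemma pivot_prod_eq_det_on:
  assumes "distinct xs" "pivots_pos xs M"
  shows "pivot_prod xs M = det_on (set xs) M"
  using assms
proof (induction xs arbitrary: M)
  case Nil
  then show ?case by (simp add: det_on_def)
next
  case (Cons a xs)
  then show ?case by (simp add: det_on_schur)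
qed

lemma pivot_prod_pos: "pivots_pos xs M \<Longrightarrow> pivot_prod xs M > 0"
  by (induction xs arbitrary: M) auto

lemma pivots_cong:
  assumes "\<And>i j. i \<in> set xs \<Longrightarrow> j \<in> set xs \<Longrightarrow> M i j = N i j"
    and "\<And>i. i \<in> set xs \<Longrightarrow> y i = z i"
  shows "pivots_pos xs M \<longleftrightarrow> pivots_pos xs N" "pivot_prod xs M = pivot_prod xs N"
    "pivot_form xs M y = pivot_form xs N z"
proof -
  have "(pivots_pos xs M \<longleftrightarrow> pivots_pos xs N) \<and> pivot_prod xs M = pivot_prod xs N \<and>
    pivot_form xs M y = pivot_form xs N z"
    using assms
  proof (induction xs arbitrary: M N y z)
    case (Cons a xs)
    have "(pivots_pos xs (schur a M) \<longleftrightarrow> pivots_pos xs (schur a N)) \<and>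
      pivot_prod xs (schur a M) = pivot_prod xs (schur a N) \<and>
      pivot_form xs (schur a M) (eliminate a M y) = pivot_form xs (schur a N) (eliminate a N z)"
      using Cons.prems by (intro Cons.IH) (auto simp: schur_def eliminate_def)
    then show ?case using Cons.prems by simp
  qed simp
  then show "pivots_pos xs M \<longleftrightarrow> pivots_pos xs N" "pivot_prod xs M = pivot_prod xs N"
    "pivot_form xs M y = pivot_form xs N z" by auto
qed

lemma pivots_pos_scale:
  assumes "\<And>i. i \<in> set xs \<Longrightarrow> d i > 0" "pivots_pos xs M"
  shows "pivots_pos xs (\<lambda>i j. d i * M i j * d j)"
  using assms
proof (induction xs arbitrary: M)
  case (Cons a xs)
  have "d a > 0" "M a a > 0" using Cons.prems by auto
  then have "d i * M i a * d a * (d a * M a j * d j) / (d a * M a a * d a) = d i * (M i a * M a j / M a a) * d j" for i j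
    by simp
  then have "schur a (\<lambda>i j. d i * M i j * d j) = (\<lambda>i j. d i * schur a M i j * d j)"
    by (simp only: schur_def right_diff_distrib left_diff_distrib)
  moreover have "pivots_pos xs (\<lambda>i j. d i * schur a M i j * d j)"
    using Cons.prems by (intro Cons.IH) auto
  ultimately show ?case using \<open>d a > 0\<close> \<open>M a a > 0\<close> by simp
qed simp

lemma det_on_scale:
  assumes "finite V"
  shows "det_on V (\<lambda>i j. d i * M i j * d j) = (\<Prod>i\<in>V. d i)\<^sup>2 * det_on V M"
  unfolding det_on_def sum_distrib_left
proof (rule sum.cong[OF refl])
  fix p assume "p \<in> {p. p permutes V}"
  then have "(\<Prod>i\<in>V. d (p i)) = (\<Prod>i\<in>V. d i)"
    using prod.permute[of p V d] by (simp add: o_def)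
  then show "of_int (sign p) * (\<Prod>i\<in>V. d i * M i (p i) * d (p i))
      = (\<Prod>i\<in>V. d i)\<^sup>2 * (of_int (sign p) * (\<Prod>i\<in>V. M i (p i)))"
    by (simp add: prod.distrib power2_eq_square)
qed

definition sym_on :: "'v set \<Rightarrow> ('v \<Rightarrow> 'v \<Rightarrow> real) \<Rightarrow> bool" where
  "sym_on V M \<longleftrightarrow> (\<forall>i\<in>V. \<forall>j\<in>V. M i j = M j i)"

lemma sym_onD: "sym_on V M \<Longrightarrow> i \<in> V \<Longrightarrow> j \<in> V \<Longrightarrow> M i j = M j i"
  by (simp add: sym_on_def)

lemma sym_on_schur:
  assumes "sym_on (insert a V) M"
  shows "sym_on V (schur a M)"
  unfolding sym_on_def
proof (intro ballI)
  fix i j assume "i \<in> V" "j \<in> V"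
  then show "schur a M i j = schur a M j i"
    using sym_onD[OF assms, of i j] sym_onD[OF assms, of i a] sym_onD[OF assms, of a j]
    by (simp add: schur_def)
qed

text \<open>If \<open>M x = z\<close>, then the restriction of \<open>x\<close> solves the eliminated system, so \<open>z\<^sup>t x = z\<^sup>t M\<^sup>-\<^sup>1 z\<close> splits into
  the contribution of the pivot and the same expression for the eliminated system.  Any solution will do;
  this allows \<open>e\<^sup>u\<close> itself to be used as the solution for one particular right hand side.\<close>

lemma pivot_form_eq:
  assumes "distinct xs" "pivots_pos xs M" "sym_on (set xs) M"
    and "\<And>i. i \<in> set xs \<Longrightarrow> (\<Sum>j\<in>set xs. M i j * x j) = z i"
  shows "pivot_form xs M z = (\<Sum>i\<in>set xs. z i * x i)"
  using assms
proof (induction xs arbitrary: M z)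
  case (Cons a xs)
  let ?V = "set xs"
  from Cons.prems have a: "a \<notin> ?V" and nz: "M a a \<noteq> 0" by auto
  have sym: "M i a = M a i" if "i \<in> ?V" for i
    using sym_onD[OF Cons.prems(3)] that by simp
  have eq: "M i a * x a + (\<Sum>j\<in>?V. M i j * x j) = z i" if "i \<in> insert a ?V" for i
    using Cons.prems(4)[of i] that a by simp
  have xa: "x a = (z a - (\<Sum>j\<in>?V. M a j * x j)) / M a a"
    using eq[of a] nz by (simp add: field_simps)
  have "pivot_form xs (schur a M) (eliminate a M z) = (\<Sum>i\<in>?V. eliminate a M z i * x i)"
  proof (rule Cons.IH)
    fix i assume i: "i \<in> ?V"
    have "(\<Sum>j\<in>?V. schur a M i j * x j)
      = (\<Sum>j\<in>?V. M i j * x j) - M i a / M a a * (\<Sum>j\<in>?V. M a j * x j)"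
      by (simp add: schur_def sum_subtractf sum_distrib_left algebra_simps)
    also have "\<dots> = eliminate a M z i"
    proof -
      have "(\<Sum>j\<in>?V. M i j * x j) = z i - M i a * x a" "(\<Sum>j\<in>?V. M a j * x j) = z a - M a a * x a"
        using eq[of i] eq[of a] i by auto
      then show ?thesis
        using nz by (simp only: eliminate_def) (simp add: field_simps)
    qed
    finally show "(\<Sum>j\<in>?V. schur a M i j * x j) = eliminate a M z i" .
  qed (use Cons.prems sym_on_schur in auto)
  also have "\<dots> = (\<Sum>i\<in>?V. z i * x i) - z a / M a a * (\<Sum>i\<in>?V. M a i * x i)"
    by (simp add: eliminate_def sum_subtractf sum_distrib_left algebra_simps sym)
  finally have "pivot_form (a # xs) M z
      = (\<Sum>i\<in>?V. z i * x i) + z a * ((z a - (\<Sum>i\<in>?V. M a i * x i)) / M a a)"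
    by (simp add: power2_eq_square diff_divide_distrib right_diff_distrib)
  moreover have "(\<Sum>i\<in>set (a # xs). z i * x i) = z a * x a + (\<Sum>i\<in>?V. z i * x i)"
    using a by simp
  ultimately show ?case
    by (simp only: xa add.commute)
qed simp

lemma pivots_pos_solvable:
  assumes "distinct xs" "pivots_pos xs M"
  shows "\<exists>x. \<forall>i\<in>set xs. (\<Sum>j\<in>set xs. M i j * x j) = z i"
  using assms
proof (induction xs arbitrary: M z)
  case (Cons a xs)
  let ?V = "set xs"
  from Cons.prems have a: "a \<notin> ?V" and nz: "M a a \<noteq> 0" by auto
  obtain x where x: "\<And>i. i \<in> ?V \<Longrightarrow> (\<Sum>j\<in>?V. schur a M i j * x j) = eliminate a M z i"
    using Cons.IH[of "schur a M" "eliminate a M z"] Cons.prems by auto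
  define y where "y = x(a := (z a - (\<Sum>j\<in>?V. M a j * x j)) / M a a)"
  have y: "(\<Sum>j\<in>?V. M i j * y j) = (\<Sum>j\<in>?V. M i j * x j)" for i
    using a by (intro sum.cong) (auto simp: y_def)
  have "(\<Sum>j\<in>insert a ?V. M i j * y j) = z i" if i: "i \<in> insert a ?V" for i
  proof (cases "i = a")
    case True
    then show ?thesis using a nz by (simp add: y) (simp add: y_def)
  next
    case False
    then have "(\<Sum>j\<in>?V. M i j * x j) - M i a / M a a * (\<Sum>j\<in>?V. M a j * x j) = z i - M i a * z a / M a a"
      using x[of i] i by (simp add: schur_def eliminate_def sum_subtractf sum_distrib_left algebra_simps)
    then have "(\<Sum>j\<in>?V. M i j * x j) = z i - M i a * y a"
      using nz by (simp add: y_def diff_divide_distrib right_diff_distrib)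
    then show ?thesis using a by (simp add: y)
  qed
  then show ?case by auto
qed simp

text \<open>The columns of a right inverse come from solving \<open>M x = e\<^sub>j\<close> by back substitution; for symmetric \<open>M\<close> its
  transpose is a left inverse, hence both coincide.\<close>

lemma pivots_pos_inverse:
  assumes xs: "distinct xs" "pivots_pos xs M" and sym: "sym_on (set xs) M"
  shows "is_inverse_on (set xs) M (inv_on (set xs) M)"
proof -
  let ?V = "set xs"
  have "\<exists>x. \<forall>i\<in>?V. (\<Sum>k\<in>?V. M i k * x k) = (if i = j then 1 else 0)" for j
    using pivots_pos_solvable[OF xs, of "\<lambda>i. if i = j then 1 else 0"] .
  then obtain X where X: "\<And>i j. i \<in> ?V \<Longrightarrow> (\<Sum>k\<in>?V. M i k * X j k) = (if i = j then 1 else 0)"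
    by metis
  have X': "(\<Sum>k\<in>?V. X i k * M k j) = (if i = j then 1 else 0)" if "i \<in> ?V" "j \<in> ?V" for i j
  proof -
    have "(\<Sum>k\<in>?V. X i k * M k j) = (\<Sum>k\<in>?V. M j k * X i k)"
      using sym_onD[OF sym] that by (intro sum.cong) simp_all
    then show ?thesis using X[of j i] that by simp
  qed
  have symX: "X i j = X j i" if "i \<in> ?V" "j \<in> ?V" for i j
  proof -
    have "X i j = (\<Sum>k\<in>?V. X i k * (\<Sum>l\<in>?V. M k l * X j l))"
      using that by (simp add: X if_distrib cong: if_cong)
    also have "\<dots> = (\<Sum>l\<in>?V. (\<Sum>k\<in>?V. X i k * M k l) * X j l)"
      by (simp add: sum_distrib_left sum_distrib_right mult.assoc) (rule sum.swap)
    also have "\<dots> = X j i"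
      using that by (simp add: X' if_distrib[of "\<lambda>x. x * _"] cong: if_cong)
    finally show ?thesis .
  qed
  have "(\<Sum>k\<in>?V. M i k * X k j) = (if i = j then 1 else 0)" if "i \<in> ?V" "j \<in> ?V" for i j
    using X[of i j] that symX by (simp cong: sum.cong)
  then have "is_inverse_on ?V M X"
    using X' by (auto simp: is_inverse_on_def)
  then show ?thesis
    unfolding inv_on_def by (rule someI[of "is_inverse_on (set xs) M"])
qed

lemma pivots_measurable:
  assumes "\<And>i j. i \<in> set xs \<Longrightarrow> j \<in> set xs \<Longrightarrow> (\<lambda>x. M x i j) \<in> borel_measurable N"
    and "\<And>i. i \<in> set xs \<Longrightarrow> (\<lambda>x. z x i) \<in> borel_measurable N"
  shows "(\<lambda>x. pivot_prod xs (M x)) \<in> borel_measurable N"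
    "(\<lambda>x. pivot_form xs (M x) (z x)) \<in> borel_measurable N"
proof -
  have "(\<lambda>x. pivot_prod xs (M x)) \<in> borel_measurable N \<and>
    (\<lambda>x. pivot_form xs (M x) (z x)) \<in> borel_measurable N"
    using assms
  proof (induction xs arbitrary: M z)
    case (Cons a xs)
    have M: "(\<lambda>x. M x i j) \<in> borel_measurable N" if "i \<in> insert a (set xs)" "j \<in> insert a (set xs)" for i j
      using Cons.prems(1)[of i j] that by simp
    have z: "(\<lambda>x. z x i) \<in> borel_measurable N" if "i \<in> insert a (set xs)" for i
      using Cons.prems(2)[of i] that by simp
    note [measurable] = M[OF insertI1 insertI1] z[OF insertI1]
    have [measurable]: "(\<lambda>x. pivot_prod xs (schur a (M x))) \<in> borel_measurable N"
      "(\<lambda>x. pivot_form xs (schur a (M x)) (eliminate a (M x) (z x))) \<in> borel_measurable N"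
    proof -
      have "(\<lambda>x. schur a (M x) i j) \<in> borel_measurable N" if "i \<in> set xs" "j \<in> set xs" for i j
      proof -
        note [measurable] = M[OF insertI2 insertI2] M[OF insertI2 insertI1] M[OF insertI1 insertI2]
        show ?thesis using that unfolding schur_def by measurable
      qed
      moreover have "(\<lambda>x. eliminate a (M x) (z x) i) \<in> borel_measurable N" if "i \<in> set xs" for i
      proof -
        note [measurable] = M[OF insertI2 insertI1] z[OF insertI2]
        show ?thesis using that unfolding eliminate_def by measurable
      qed
      ultimately show "(\<lambda>x. pivot_prod xs (schur a (M x))) \<in> borel_measurable N"
        "(\<lambda>x. pivot_form xs (schur a (M x)) (eliminate a (M x) (z x))) \<in> borel_measurable N"
        using Cons.IH[of "\<lambda>x. schur a (M x)" "\<lambda>x. eliminate a (M x) (z x)"] by simp_all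
    qed
    show ?case by (simp only: pivot_prod.simps pivot_form.simps) measurable
  qed simp
  then show "(\<lambda>x. pivot_prod xs (M x)) \<in> borel_measurable N"
    "(\<lambda>x. pivot_form xs (M x) (z x)) \<in> borel_measurable N" by auto
qed

section \<open>One-dimensional and Gaussian integrals\<close>

lemma nn_integral_gauss:
  fixes p c :: real
  assumes "p > 0"
  shows "(\<integral>\<^sup>+x. ennreal (exp (- (p / 2) * (x + c)\<^sup>2)) \<partial>lborel) = ennreal (sqrt (2 * pi / p))"
proof -
  define \<sigma> where "\<sigma> = 1 / sqrt p"
  have \<sigma>: "\<sigma> > 0" "\<sigma>\<^sup>2 = 1 / p"
    using assms by (auto simp: \<sigma>_def power_divide)
  have "exp (- (p / 2) * (x + c)\<^sup>2) = sqrt (2 * pi / p) * normal_density (- c) \<sigma> x" for x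
    using assms by (simp add: normal_density_def \<sigma>)
  then have "(\<integral>\<^sup>+x. ennreal (exp (- (p / 2) * (x + c)\<^sup>2)) \<partial>lborel)
      = (\<integral>\<^sup>+x. ennreal (sqrt (2 * pi / p)) * ennreal (normal_density (- c) \<sigma> x) \<partial>lborel)"
    using assms by (simp add: ennreal_mult)
  also have "\<dots> = ennreal (sqrt (2 * pi / p)) * (\<integral>\<^sup>+x. ennreal (normal_density (- c) \<sigma> x) \<partial>lborel)"
    by (intro nn_integral_cmult) simp
  also have "(\<integral>\<^sup>+x. ennreal (normal_density (- c) \<sigma> x) \<partial>lborel) = 1"
    using \<sigma>(1) by (subst nn_integral_eq_integral) auto
  finally show ?thesis by simp
qed

interpretation lborel_product: product_sigma_finite "\<lambda>_::'v. lborel :: real measure" ..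

lemma complete_square_pivot:
  assumes fin: "finite V" and a: "a \<notin> V" and nz: "M a a \<noteq> 0" and sym: "sym_on (insert a V) M"
  shows "(\<Sum>i\<in>insert a V. \<Sum>j\<in>insert a V. s i * M i j * s j)
    = M a a * (s a + (\<Sum>j\<in>V. M a j * s j) / M a a)\<^sup>2 + (\<Sum>i\<in>V. \<Sum>j\<in>V. s i * schur a M i j * s j)"
proof -
  define S where "S = (\<Sum>j\<in>V. M a j * s j)"
  have sy: "M i a = M a i" if "i \<in> V" for i
    using sym_onD[OF sym, of i a] that by simp
  have 1: "(\<Sum>i\<in>insert a V. \<Sum>j\<in>insert a V. s i * M i j * s j)
    = M a a * (s a)\<^sup>2 + s a * S + S * s a + (\<Sum>i\<in>V. \<Sum>j\<in>V. s i * M i j * s j)"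
    using fin a sy by (simp add: S_def sum.distrib sum_distrib_left sum_distrib_right power2_eq_square mult_ac)
  have "(\<Sum>i\<in>V. \<Sum>j\<in>V. s i * schur a M i j * s j)
      = (\<Sum>i\<in>V. \<Sum>j\<in>V. s i * M i j * s j) - (\<Sum>i\<in>V. \<Sum>j\<in>V. (M a i * s i) * (M a j * s j)) / M a a"
    unfolding sum_subtractf[symmetric] sum_divide_distrib
    by (intro sum.cong refl) (simp add: schur_def sy field_simps)
  also have "(\<Sum>i\<in>V. \<Sum>j\<in>V. (M a i * s i) * (M a j * s j)) = S * S"
    by (simp add: S_def sum_product)
  finally have 2: "(\<Sum>i\<in>V. \<Sum>j\<in>V. s i * schur a M i j * s j)
      = (\<Sum>i\<in>V. \<Sum>j\<in>V. s i * M i j * s j) - S * S / M a a" .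
  show ?thesis
    unfolding 1 2 S_def[symmetric] using nz by (simp add: power2_eq_square field_simps)
qed

text \<open>Completing the square in the variable of the first pivot leaves the quadratic form of the Schur complement
  in the remaining variables.\<close>

lemma gaussian_integral:
  assumes "distinct xs" "pivots_pos xs M" "sym_on (set xs) M"
  shows "(\<integral>\<^sup>+s. ennreal (exp (- 1 / 2 * (\<Sum>i\<in>set xs. \<Sum>j\<in>set xs. s i * M i j * s j))) \<partial>Pi\<^sub>M (set xs) (\<lambda>_. lborel))
    = ennreal (sqrt ((2 * pi) ^ length xs / pivot_prod xs M))"
  using assms
proof (induction xs arbitrary: M)
  case Nil
  then show ?case
    by (simp add: PiM_empty nn_integral_count_space_finite)
next
  case (Cons a xs)
  let ?V = "set xs"
  let ?Q = "\<lambda>V M s. (\<Sum>i\<in>V. \<Sum>j\<in>V. s i * M i j * s j) :: real"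
  from Cons.prems have a: "a \<notin> ?V" and p: "M a a > 0" by auto
  have split: "?Q (insert a ?V) M (s(a := y))
      = M a a * (y + (\<Sum>j\<in>?V. M a j * s j) / M a a)\<^sup>2 + ?Q ?V (schur a M) s" for s y
  proof -
    have "(\<Sum>j\<in>?V. M a j * (s(a := y)) j) = (\<Sum>j\<in>?V. M a j * s j)"
      using a by (intro sum.cong) auto
    moreover have "?Q ?V (schur a M) (s(a := y)) = ?Q ?V (schur a M) s"
      using a by (intro sum.cong refl) auto
    ultimately show ?thesis
      using Cons.prems a p by (subst complete_square_pivot) auto
  qed
  have "(\<integral>\<^sup>+s. ennreal (exp (- 1 / 2 * ?Q (insert a ?V) M s)) \<partial>Pi\<^sub>M (insert a ?V) (\<lambda>_. lborel))
    = (\<integral>\<^sup>+s. (\<integral>\<^sup>+y. ennreal (exp (- 1 / 2 * ?Q (insert a ?V) M (s(a := y)))) \<partial>lborel) \<partial>Pi\<^sub>M ?V (\<lambda>_. lborel))"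
    using a by (intro lborel_product.product_nn_integral_insert) auto
  also have "\<dots> = (\<integral>\<^sup>+s. ennreal (sqrt (2 * pi / M a a)) * ennreal (exp (- 1 / 2 * ?Q ?V (schur a M) s)) \<partial>Pi\<^sub>M ?V (\<lambda>_. lborel))"
  proof (rule nn_integral_cong)
    fix s :: "'a \<Rightarrow> real"
    let ?c = "(\<Sum>j\<in>?V. M a j * s j) / M a a"
    have "ennreal (exp (- 1 / 2 * ?Q (insert a ?V) M (s(a := y))))
        = ennreal (exp (- (M a a / 2) * (y + ?c)\<^sup>2)) * ennreal (exp (- 1 / 2 * ?Q ?V (schur a M) s))" for y
      unfolding split by (simp add: ennreal_mult[symmetric] exp_add[symmetric] algebra_simps)
    then show "(\<integral>\<^sup>+y. ennreal (exp (- 1 / 2 * ?Q (insert a ?V) M (s(a := y)))) \<partial>lborel)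
        = ennreal (sqrt (2 * pi / M a a)) * ennreal (exp (- 1 / 2 * ?Q ?V (schur a M) s))"
      using nn_integral_gauss[OF p, of ?c] by (simp add: nn_integral_multc)
  qed
  also have "\<dots> = ennreal (sqrt (2 * pi / M a a)) * ennreal (sqrt ((2 * pi) ^ length xs / pivot_prod xs (schur a M)))"
    using Cons.prems Cons.IH[of "schur a M"] sym_on_schur[of a ?V M] by (simp add: nn_integral_cmult)
  also have "\<dots> = ennreal (sqrt ((2 * pi) ^ length (a # xs) / pivot_prod (a # xs) M))"
    using p pivot_prod_pos[of xs "schur a M"] Cons.prems
    by (simp add: ennreal_mult[symmetric] real_sqrt_mult[symmetric])
  finally show ?case by simp
qed

text \<open>Every increasing bijection \<open>g\<close> of the line pulls the Gaussian integral back to itself.\<close>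

lemma nn_integral_gauss_substitution:
  fixes g g' :: "real \<Rightarrow> real"
  assumes der: "\<And>v. (g has_real_derivative g' v) (at v)" and pos: "\<And>v. g' v > 0" and surj: "surj g"
    and [measurable]: "g \<in> borel_measurable borel" "g' \<in> borel_measurable borel"
  shows "(\<integral>\<^sup>+v. ennreal (g' v * exp (- (g v)\<^sup>2 / 2)) \<partial>lborel) = ennreal (sqrt (2 * pi))"
proof -
  let ?f = "\<lambda>x::real. exp (- x\<^sup>2 / 2)"
  have "?f = (\<lambda>x. sqrt (2 * pi) * std_normal_density x)"
    by (simp add: fun_eq_iff std_normal_density_def)
  then have "integrable lborel ?f" "integral\<^sup>L lborel ?f = sqrt (2 * pi)"
    by simp_all
  then have f: "(?f has_integral sqrt (2 * pi)) UNIV"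
    using has_integral_integral_lborel by metis
  then have "?f absolutely_integrable_on UNIV"
    by (intro nonnegative_absolutely_integrable_1) auto
  moreover have "strict_mono g"
    using der pos by (intro strict_monoI) (metis DERIV_pos_imp_increasing)
  then have "inj_on g UNIV"
    by (rule strict_mono_imp_inj_on)
  ultimately have "(\<lambda>v. \<bar>g' v\<bar> * ?f (g v)) absolutely_integrable_on UNIV \<and>
      integral UNIV (\<lambda>v. \<bar>g' v\<bar> * ?f (g v)) = sqrt (2 * pi)"
    using has_absolute_integral_change_of_variables_1'[of UNIV g g' ?f "sqrt (2 * pi)"] der surj f
    by (auto intro: integral_unique)
  then have "((\<lambda>v. \<bar>g' v\<bar> * ?f (g v)) has_integral sqrt (2 * pi)) UNIV"
    using set_lebesgue_integral_eq_integral(1) by (metis integrable_integral)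
  then have "((\<lambda>v. g' v * ?f (g v)) has_integral sqrt (2 * pi)) UNIV"
    using pos by (simp add: abs_of_pos)
  then have "integral\<^sup>N lborel (\<lambda>v. ennreal (indicator UNIV v * (g' v * ?f (g v)))) = ennreal (sqrt (2 * pi))"
    using pos by (intro nn_integral_has_integral_lborel) (auto simp: less_imp_le)
  then show ?thesis by simp
qed

text \<open>With \<open>t = exp v\<close> this is the integral of \<open>exp (- (al\<^sup>2 t + c\<^sup>2 / t) / 2) / sqrt t\<close> over \<open>t > 0\<close>, a modified Bessel
  function of order one half and hence elementary.  The substitution
  \<open>x = al * exp (v / 2) - c * exp (- v / 2)\<close> turns the exponent into \<open>- x\<^sup>2 / 2 - al * c\<close>.\<close>

lemma nn_integral_half_bessel:
  fixes al c :: real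
  assumes al: "al > 0" and c: "c > 0"
  shows "(\<integral>\<^sup>+v. ennreal (exp (v / 2 - al\<^sup>2 / 2 * exp v - c\<^sup>2 / 2 * exp (- v))) \<partial>lborel)
    = ennreal (sqrt (2 * pi) / al * exp (- al * c))"
proof -
  define F where "F = (\<lambda>v. exp (- al\<^sup>2 / 2 * exp v - c\<^sup>2 / 2 * exp (- v)))"
  define g where "g = (\<lambda>v. al * exp (v / 2) - c * exp (- v / 2))"
  define g' where "g' = (\<lambda>v. (al * exp (v / 2) + c * exp (- v / 2)) / 2)"
  define G where "G = (\<integral>\<^sup>+v. ennreal (al * exp (v / 2) * F v) \<partial>lborel)"
  have [measurable]: "F \<in> borel_measurable borel" "g \<in> borel_measurable borel" "g' \<in> borel_measurable borel"
    by (auto simp: F_def g_def g'_def)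
  have F0: "F v \<ge> 0" for v by (simp add: F_def)
  \<comment> \<open>The map \<open>v \<mapsto> 2 * ln (c / al) - v\<close> preserves \<open>F\<close> and exchanges the two exponentials in \<open>g\<close>;
     averaging both forms of the integral produces the factor \<open>g'\<close> for the substitution.\<close>
  have refl: "G = (\<integral>\<^sup>+v. ennreal (c * exp (- v / 2) * F v) \<partial>lborel)"
  proof -
    let ?t = "2 * ln (c / al)"
    have e: "exp (?t + - 1 * v) = (c / al)\<^sup>2 * exp (- v)" for v
    proof -
      have "exp ?t = (c / al)\<^sup>2"
        using al c by (simp add: exp_double[symmetric] exp_double)
      then show ?thesis by (simp add: exp_diff exp_minus divide_inverse)
    qed
    have e2: "exp ((?t + - 1 * v) / 2) = c / al * exp (- v / 2)" for v
    proof -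
      have "(?t + - 1 * v) / 2 = ln (c / al) + - v / 2" by (simp add: field_simps)
      then show ?thesis using al c by (simp only: exp_add) simp
    qed
    have e3: "exp (- (?t + - 1 * v)) = (al / c)\<^sup>2 * exp v" for v
      unfolding exp_minus e using al c by (simp add: field_simps exp_minus)
    have "al * exp ((?t + - 1 * v) / 2) * F (?t + - 1 * v) = c * exp (- v / 2) * F v" for v
      unfolding F_def e e2 e3 using al c by (simp add: power_divide)
    then show ?thesis
      unfolding G_def by (subst nn_integral_real_affine[where c = "-1" and t = ?t]) simp_all
  qed
  have "2 * G = G + (\<integral>\<^sup>+v. ennreal (c * exp (- v / 2) * F v) \<partial>lborel)"
    using refl by (simp add: mult_2)
  also have "\<dots> = (\<integral>\<^sup>+v. ennreal (al * exp (v / 2) * F v) + ennreal (c * exp (- v / 2) * F v) \<partial>lborel)"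
    unfolding G_def by (subst nn_integral_add) auto
  also have "\<dots> = (\<integral>\<^sup>+v. ennreal (2 * exp (- al * c)) * ennreal (g' v * exp (- (g v)\<^sup>2 / 2)) \<partial>lborel)"
  proof (rule nn_integral_cong)
    fix v :: real
    have sq: "(exp (v / 2))\<^sup>2 = exp v" "(exp (- v / 2))\<^sup>2 = exp (- v)" "exp (v / 2) * exp (- v / 2) = 1"
      by (simp_all add: exp_double[symmetric] exp_add[symmetric])
    have "(g v)\<^sup>2 = al\<^sup>2 * (exp (v / 2))\<^sup>2 + c\<^sup>2 * (exp (- v / 2))\<^sup>2 - 2 * (al * c) * (exp (v / 2) * exp (- v / 2))"
      unfolding g_def by (simp add: power2_eq_square algebra_simps)
    then have "(g v)\<^sup>2 = al\<^sup>2 * exp v + c\<^sup>2 * exp (- v) - 2 * (al * c)"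
      unfolding sq by simp
    then have "exp (- al * c) * exp (- (g v)\<^sup>2 / 2) = F v"
      by (simp add: F_def exp_add[symmetric] diff_divide_distrib add_divide_distrib)
    then have "2 * exp (- al * c) * (g' v * exp (- (g v)\<^sup>2 / 2)) = al * exp (v / 2) * F v + c * exp (- v / 2) * F v"
      by (simp add: g'_def algebra_simps)
    then show "ennreal (al * exp (v / 2) * F v) + ennreal (c * exp (- v / 2) * F v)
        = ennreal (2 * exp (- al * c)) * ennreal (g' v * exp (- (g v)\<^sup>2 / 2))"
      using al c F0 by (simp add: ennreal_plus[symmetric] ennreal_mult'[symmetric] g'_def del: ennreal_plus)
  qed
  also have "\<dots> = ennreal (2 * exp (- al * c)) * ennreal (sqrt (2 * pi))"
  proof -
    have "surj g"
    proof (rule surjI)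
      fix x
      define r where "r = sqrt (x\<^sup>2 + 4 * al * c)"
      define y where "y = (x + r) / (2 * al)"
      have r2: "r\<^sup>2 = x\<^sup>2 + 4 * al * c"
        using al c by (simp add: r_def)
      have "\<bar>x\<bar> < r"
        unfolding r_def using al c by (intro real_less_rsqrt) auto
      then have r: "x + r > 0" and y: "y > 0"
        using al by (auto simp: y_def)
      have 1: "al * y = (x + r) / 2"
        using al by (simp add: y_def)
      have "(r - x) / 2 * y = (r\<^sup>2 - x\<^sup>2) / (4 * al)"
        by (simp add: y_def power2_eq_square algebra_simps)
      also have "\<dots> = c"
        unfolding r2 using al by simp
      finally have 2: "c / y = (r - x) / 2"
        using y by (simp add: eq_divide_imp divide_eq_eq)
      have "al * y - c / y = x"
        unfolding 1 2 by (simp add: diff_divide_distrib add_divide_distrib)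
      moreover have "exp (2 * ln y / 2) = y" "exp (- (2 * ln y) / 2) = 1 / y"
        using y by (simp_all add: exp_minus inverse_eq_divide)
      ultimately show "g (2 * ln y) = x"
        unfolding g_def by (simp only: times_divide_eq_right mult_1_right)
    qed
    moreover have "(g has_real_derivative g' v) (at v)" for v
      unfolding g_def g'_def by (auto intro!: derivative_eq_intros simp: field_simps)
    moreover have "g' v > 0" for v
      using al c by (simp add: g'_def add_pos_pos)
    ultimately have "(\<integral>\<^sup>+v. ennreal (g' v * exp (- (g v)\<^sup>2 / 2)) \<partial>lborel) = ennreal (sqrt (2 * pi))"
      by (intro nn_integral_gauss_substitution) auto
    then show ?thesis
      by (subst nn_integral_cmult) simp_all
  qed
  also have "\<dots> = 2 * ennreal (exp (- al * c) * sqrt (2 * pi))"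
    by (simp add: ennreal_mult mult.assoc)
  finally have G: "G = ennreal (exp (- al * c) * sqrt (2 * pi))"
    by (simp add: ennreal_mult_cancel_left)
  have "exp (v / 2 - al\<^sup>2 / 2 * exp v - c\<^sup>2 / 2 * exp (- v)) = 1 / al * (al * exp (v / 2) * F v)" for v
    using al by (simp add: F_def exp_add[symmetric] exp_diff)
  then have "(\<integral>\<^sup>+v. ennreal (exp (v / 2 - al\<^sup>2 / 2 * exp v - c\<^sup>2 / 2 * exp (- v))) \<partial>lborel)
    = (\<integral>\<^sup>+v. ennreal (1 / al) * ennreal (al * exp (v / 2) * F v) \<partial>lborel)"
    using al by (simp only: ennreal_mult'[symmetric] zero_le_divide_1_iff less_imp_le)
  also have "\<dots> = ennreal (1 / al) * G"
    unfolding G_def by (intro nn_integral_cmult) simp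
  also have "\<dots> = ennreal (sqrt (2 * pi) / al * exp (- al * c))"
    using al by (simp add: G ennreal_mult'[symmetric] mult.commute)
  finally show ?thesis .
qed

section \<open>Eliminating a vertex\<close>

text \<open>For the graph of the theorem, \<open>pot V W \<omega> u i\<close> is \<open>2 \<beta>\<^sub>i(u)\<close> if \<open>\<omega> i\<close> is the weight of
  the edge between \<open>i\<close> and \<open>\<delta>\<close>, where \<open>u = 0\<close>.  Diagonal weights are allowed:
  elimination creates self-loops, and since these contribute equally to the potential and to the
  diagonal of \<open>W\<close>, they cancel in the operator \<open>schroedinger\<close>.\<close>

definition pot :: "'v set \<Rightarrow> ('v \<Rightarrow> 'v \<Rightarrow> real) \<Rightarrow> ('v \<Rightarrow> real) \<Rightarrow> ('v \<Rightarrow> real) \<Rightarrow> 'v \<Rightarrow> real" where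
  "pot V W \<omega> u i = exp (- u i) * ((\<Sum>j\<in>V. W i j * exp (u j)) + \<omega> i)"

definition schroedinger :: "'v set \<Rightarrow> ('v \<Rightarrow> 'v \<Rightarrow> real) \<Rightarrow> ('v \<Rightarrow> real) \<Rightarrow> ('v \<Rightarrow> real) \<Rightarrow> 'v \<Rightarrow> 'v \<Rightarrow> real" where
  "schroedinger V W \<omega> u i j = (if i = j then pot V W \<omega> u i else 0) - W i j"

text \<open>The weights and the pinning after removal of the vertex \<open>a\<close>, given the value \<open>t\<close> of its pivot:
  two neighbours of \<open>a\<close> become joined through \<open>a\<close>, as in the reduction of electrical networks.\<close>

definition weights_elim :: "'v \<Rightarrow> real \<Rightarrow> ('v \<Rightarrow> 'v \<Rightarrow> real) \<Rightarrow> 'v \<Rightarrow> 'v \<Rightarrow> real" where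
  "weights_elim a t W = (\<lambda>i j. W i j + W i a * W a j / t)"

definition field_elim :: "'v \<Rightarrow> real \<Rightarrow> ('v \<Rightarrow> 'v \<Rightarrow> real) \<Rightarrow> ('v \<Rightarrow> real) \<Rightarrow> 'v \<Rightarrow> real" where
  "field_elim a t W \<omega> = (\<lambda>i. \<omega> i + W i a * \<omega> a / t)"

text \<open>The last condition expresses that every vertex is connected to the reference vertex, by asking that no
  nonempty set of vertices be isolated from its complement.  In this cut form connectedness is inherited
  easily when a vertex is removed, and it makes every pivot positive.\<close>

definition pinned :: "'v set \<Rightarrow> ('v \<Rightarrow> 'v \<Rightarrow> real) \<Rightarrow> ('v \<Rightarrow> real) \<Rightarrow> bool" where
  "pinned V W \<omega> \<longleftrightarrow> sym_on V W \<and> (\<forall>i\<in>V. \<forall>j\<in>V. W i j \<ge> 0) \<and> (\<forall>i\<in>V. \<omega> i \<ge> 0) \<and>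
     (\<forall>S\<subseteq>V. S \<noteq> {} \<longrightarrow> (\<exists>i\<in>S. \<omega> i > 0 \<or> (\<exists>j\<in>V - S. W i j > 0)))"

text \<open>An edge that leaves \<open>S\<close> for a vertex other than \<open>a\<close> survives.  If \<open>S\<close> is joined only to \<open>a\<close>, then \<open>S\<close> together with
  \<open>a\<close> has an outgoing edge at \<open>a\<close>, and elimination replaces the path through \<open>a\<close> by an edge.\<close>

lemma pinned_elim:
  assumes p: "pinned (insert a V) W \<omega>" and a: "a \<notin> V" and t: "t > 0"
  shows "pinned V (weights_elim a t W) (field_elim a t W \<omega>)"
proof -
  have sym: "sym_on (insert a V) W"
    and W: "\<And>i j. i \<in> insert a V \<Longrightarrow> j \<in> insert a V \<Longrightarrow> W i j \<ge> 0"
    and \<omega>: "\<And>i. i \<in> insert a V \<Longrightarrow> \<omega> i \<ge> 0"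
    and cut: "\<And>S. S \<subseteq> insert a V \<Longrightarrow> S \<noteq> {} \<Longrightarrow> \<exists>i\<in>S. \<omega> i > 0 \<or> (\<exists>j\<in>insert a V - S. W i j > 0)"
    using p by (auto simp: pinned_def)
  have W': "W i a * W a j / t \<ge> 0" if "i \<in> V" "j \<in> V" for i j
    using W that t by simp
  have \<omega>': "W i a * \<omega> a / t \<ge> 0" if "i \<in> V" for i
    using W \<omega> that t by simp
  show ?thesis
    unfolding pinned_def
  proof (intro conjI ballI allI impI)
    show "sym_on V (weights_elim a t W)"
      unfolding sym_on_def
    proof (intro ballI)
      fix i j assume "i \<in> V" "j \<in> V"
      then show "weights_elim a t W i j = weights_elim a t W j i"
        using sym_onD[OF sym, of i j] sym_onD[OF sym, of i a] sym_onD[OF sym, of a j]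
        by (simp add: weights_elim_def)
    qed
    show "weights_elim a t W i j \<ge> 0" if "i \<in> V" "j \<in> V" for i j
      using W W' that by (simp add: weights_elim_def)
    show "field_elim a t W \<omega> i \<ge> 0" if "i \<in> V" for i
      using \<omega> \<omega>' that by (simp add: field_elim_def)
    fix S assume S: "S \<subseteq> V" "S \<noteq> {}"
    have direct: "\<exists>i\<in>S. field_elim a t W \<omega> i > 0 \<or> (\<exists>j\<in>V - S. weights_elim a t W i j > 0)"
      if i: "i \<in> S" and pos: "\<omega> i > 0 \<or> (\<exists>j\<in>V - S. W i j > 0)" for i
    proof -
      have "i \<in> V" using i S by auto
      from pos show ?thesis
      proof
        assume "\<omega> i > 0"
        then have "field_elim a t W \<omega> i > 0"
          using \<omega>'[OF \<open>i \<in> V\<close>] by (simp add: field_elim_def)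
        then show ?thesis using i by blast
      next
        assume "\<exists>j\<in>V - S. W i j > 0"
        then obtain j where j: "j \<in> V - S" "W i j > 0" by blast
        then have "weights_elim a t W i j > 0"
          using W'[OF \<open>i \<in> V\<close>, of j] by (simp add: weights_elim_def)
        then show ?thesis using i j by blast
      qed
    qed
    obtain i where i: "i \<in> S" "\<omega> i > 0 \<or> (\<exists>j\<in>insert a V - S. W i j > 0)"
      using cut[of S] S by blast
    show "\<exists>i\<in>S. field_elim a t W \<omega> i > 0 \<or> (\<exists>j\<in>V - S. weights_elim a t W i j > 0)"
    proof (cases "\<omega> i > 0 \<or> (\<exists>j\<in>V - S. W i j > 0)")
      case True
      then show ?thesis using direct i by blast
    next
      case False
      then have ia: "W i a > 0" using i by auto
      have iV: "i \<in> V" using i S by auto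
      obtain k where k: "k \<in> insert a S" "\<omega> k > 0 \<or> (\<exists>j\<in>insert a V - insert a S. W k j > 0)"
        using cut[of "insert a S"] S by blast
      show ?thesis
      proof (cases "k = a")
        case False
        then show ?thesis using direct[of k] k by blast
      next
        case True
        then consider "\<omega> a > 0" | j where "j \<in> V - S" "W a j > 0"
          using k by auto
        then show ?thesis
        proof cases
          case 1
          then have "field_elim a t W \<omega> i > 0"
            using ia t \<omega>[of i] iV by (simp add: field_elim_def add_nonneg_pos)
          then show ?thesis using i by blast
        next
          case (2 j)
          then have "weights_elim a t W i j > 0"
            using ia t W[of i j] iV by (simp add: weights_elim_def add_nonneg_pos)
          then show ?thesis using i 2 by blast
        qed
      qed
    qed
  qed
qed

lemma pinned_outflow_pos:
  assumes p: "pinned (insert a V) W \<omega>" and a: "a \<notin> V" and fin: "finite V"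
  shows "(\<Sum>j\<in>V. W a j * exp (u j)) + \<omega> a > 0"
proof -
  have W: "\<And>j. j \<in> V \<Longrightarrow> W a j \<ge> 0" and \<omega>: "\<omega> a \<ge> 0"
    using p by (auto simp: pinned_def)
  have "\<forall>S\<subseteq>insert a V. S \<noteq> {} \<longrightarrow> (\<exists>i\<in>S. \<omega> i > 0 \<or> (\<exists>j\<in>insert a V - S. W i j > 0))"
    using p by (simp add: pinned_def)
  from this[rule_format, of "{a}"] consider "\<omega> a > 0" | j where "j \<in> V" "W a j > 0"
    by auto
  then show ?thesis
  proof cases
    case 1
    then show ?thesis using W by (intro add_nonneg_pos sum_nonneg) auto
  next
    case (2 j)
    then have "(\<Sum>j\<in>V. W a j * exp (u j)) > 0"
      using W fin by (intro sum_pos2[of V j]) auto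
    then show ?thesis using \<omega> by simp
  qed
qed

lemma pot_cong:
  assumes "\<And>j. j \<in> insert i V \<Longrightarrow> u j = v j"
  shows "pot V W \<omega> u i = pot V W \<omega> v i"
  using assms by (simp add: pot_def)

text \<open>The equation for \<open>u a\<close> says that \<open>exp \<circ> u\<close> solves row \<open>a\<close> of the linear system with matrix
  \<open>schroedinger\<close> and right hand side \<open>\<omega>\<close>, the pivot being \<open>t\<close>.  Substituting it into the other rows gives potentials of
  exactly the same form.\<close>

lemma pot_elim:
  assumes a: "a \<notin> V" and fin: "finite V" and t: "t > 0"
    and ua: "exp (u a) = ((\<Sum>j\<in>V. W a j * exp (u j)) + \<omega> a) / t"
  shows "pot (insert a V) W \<omega> u a = t + W a a"
    and "pot (insert a V) W \<omega> u i = pot V (weights_elim a t W) (field_elim a t W \<omega>) u i"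
proof -
  let ?K = "(\<Sum>j\<in>V. W a j * exp (u j)) + \<omega> a"
  have K: "?K = t * exp (u a)" using ua t by (simp add: field_simps)
  have "pot (insert a V) W \<omega> u a = exp (- u a) * (W a a * exp (u a) + ?K)"
    using a fin by (simp add: pot_def add.assoc)
  also have "\<dots> = t + W a a"
    unfolding K by (simp add: algebra_simps exp_minus)
  finally show "pot (insert a V) W \<omega> u a = t + W a a" .
  have "(\<Sum>j\<in>V. weights_elim a t W i j * exp (u j)) + field_elim a t W \<omega> i
      = (\<Sum>j\<in>V. W i j * exp (u j)) + \<omega> i + W i a * (?K / t)"
    by (simp add: weights_elim_def field_elim_def sum.distrib sum_distrib_left algebra_simps
        sum_divide_distrib add_divide_distrib)
  then show "pot (insert a V) W \<omega> u i = pot V (weights_elim a t W) (field_elim a t W \<omega>) u i"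
    using a fin unfolding pot_def ua[symmetric] by (simp add: add_ac)
qed

text \<open>The family of operators \<open>schroedinger\<close> is closed under Gaussian elimination: the Schur complement of a
  vertex is the operator of the reduced graph at the same field \<open>u\<close>.  This is what makes the
  induction on the number of vertices possible.\<close>

lemma schroedinger_elim:
  assumes a: "a \<notin> V" and fin: "finite V" and t: "t > 0"
    and ua: "exp (u a) = ((\<Sum>j\<in>V. W a j * exp (u j)) + \<omega> a) / t"
  shows "schroedinger (insert a V) W \<omega> u a a = t"
    and "i \<in> V \<Longrightarrow> j \<in> V \<Longrightarrow> schur a (schroedinger (insert a V) W \<omega> u) i j
      = schroedinger V (weights_elim a t W) (field_elim a t W \<omega>) u i j"
    and "i \<in> V \<Longrightarrow> eliminate a (schroedinger (insert a V) W \<omega> u) z i = field_elim a t W z i"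
proof -
  note pe = pot_elim[where W = W and \<omega> = \<omega> and u = u, OF assms]
  show 1: "schroedinger (insert a V) W \<omega> u a a = t"
    by (simp add: schroedinger_def pe(1))
  show "i \<in> V \<Longrightarrow> j \<in> V \<Longrightarrow> schur a (schroedinger (insert a V) W \<omega> u) i j
      = schroedinger V (weights_elim a t W) (field_elim a t W \<omega>) u i j"
    using a unfolding schur_def 1
    by (auto simp: schroedinger_def pe(2) weights_elim_def[of a t W])
  show "i \<in> V \<Longrightarrow> eliminate a (schroedinger (insert a V) W \<omega> u) z i = field_elim a t W z i"
    using a unfolding eliminate_def 1 by (auto simp: schroedinger_def field_elim_def)
qed

lemma pivots_pos_schroedinger:
  assumes "distinct xs" "pinned (set xs) W \<omega>"
  shows "pivots_pos xs (schroedinger (set xs) W \<omega> u)"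
  using assms
proof (induction xs arbitrary: W \<omega>)
  case (Cons a xs)
  let ?V = "set xs"
  define t where "t = ((\<Sum>j\<in>?V. W a j * exp (u j)) + \<omega> a) / exp (u a)"
  have a: "a \<notin> ?V" and p: "pinned (insert a ?V) W \<omega>" using Cons.prems by auto
  have t: "t > 0"
    using pinned_outflow_pos[OF p a] by (simp add: t_def)
  have "((\<Sum>j\<in>?V. W a j * exp (u j)) + \<omega> a) > 0"
    using pinned_outflow_pos[OF p a] by simp
  then have ua: "exp (u a) = ((\<Sum>j\<in>?V. W a j * exp (u j)) + \<omega> a) / t"
    by (simp add: t_def)
  note el = schroedinger_elim[where W = W and \<omega> = \<omega> and u = u, OF a finite_set t ua]
  have "pivots_pos xs (schur a (schroedinger (insert a ?V) W \<omega> u))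
      = pivots_pos xs (schroedinger ?V (weights_elim a t W) (field_elim a t W \<omega>) u)"
    using el(2) by (intro pivots_cong(1)[where y = "\<lambda>_. 0" and z = "\<lambda>_. 0"]) auto
  then show ?case
    using Cons.IH[OF _ pinned_elim[OF p a t]] Cons.prems t el(1) by simp
qed simp

text \<open>Up to constants, the integrand of the Laplace transform after the Gaussian variables \<open>s\<close> have been integrated
  out, with \<open>\<alpha> = sqrt (1 + \<lambda>)\<close>.  The pinning \<open>\<omega>\<close> that defines \<open>u\<close> and the vector \<open>z\<close> in the quadratic form are kept
  independent; in the application \<open>z = \<omega> - \<theta>\<close>.\<close>

definition reduced_density ::
    "('v \<Rightarrow> real) \<Rightarrow> 'v list \<Rightarrow> ('v \<Rightarrow> 'v \<Rightarrow> real) \<Rightarrow> ('v \<Rightarrow> real) \<Rightarrow> ('v \<Rightarrow> real) \<Rightarrow> ('v \<Rightarrow> real) \<Rightarrow> real" where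
  "reduced_density \<alpha> xs W \<omega> z u =
     sqrt (pivot_prod xs (schroedinger (set xs) W \<omega> u)) *
     exp (- (\<Sum>i\<in>set xs. (\<alpha> i)\<^sup>2 * pot (set xs) W \<omega> u i) / 2
          - pivot_form xs (schroedinger (set xs) W \<omega> u) z / 2)"

text \<open>The variable \<open>u a\<close> is replaced by the logarithm \<open>v\<close> of the pivot of \<open>a\<close>.  For fixed other coordinates this is a
  reflection and translation of the line, so it preserves Lebesgue measure.\<close>

lemma reduced_density_elim:
  assumes a: "a \<notin> set xs" and p: "pinned (insert a (set xs)) W \<omega>"
    and K: "K = (\<Sum>j\<in>set xs. W a j * exp (u j)) + \<omega> a"
  shows "reduced_density \<alpha> (a # xs) W \<omega> z (u(a := ln K - v))
    = exp (v / 2 - (\<alpha> a)\<^sup>2 / 2 * (exp v + W a a) - (z a)\<^sup>2 / 2 * exp (- v)) *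
      reduced_density \<alpha> xs (weights_elim a (exp v) W) (field_elim a (exp v) W \<omega>) (field_elim a (exp v) W z) u"
proof -
  let ?V = "set xs"
  let ?u = "u(a := ln K - v)"
  let ?W = "weights_elim a (exp v) W" and ?\<omega> = "field_elim a (exp v) W \<omega>"
  have K0: "K > 0" unfolding K using pinned_outflow_pos[OF p a] by simp
  have off: "(\<Sum>j\<in>?V. W a j * exp (?u j)) + \<omega> a = K"
    unfolding K using a by (intro arg_cong2[where f = "(+)"] sum.cong refl) auto
  have ua: "exp (?u a) = ((\<Sum>j\<in>?V. W a j * exp (?u j)) + \<omega> a) / exp v"
    unfolding off using K0 by (simp add: exp_diff)
  have pot': "pot ?V ?W ?\<omega> ?u i = pot ?V ?W ?\<omega> u i" if "i \<in> ?V" for i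
    using a that by (intro pot_cong) auto
  have H': "schroedinger ?V ?W ?\<omega> ?u i j = schroedinger ?V ?W ?\<omega> u i j" if "i \<in> ?V" for i j
    using pot'[OF that] by (cases "i = j") (simp_all add: schroedinger_def)
  note el = schroedinger_elim[where W = W and \<omega> = \<omega> and u = ?u, OF a finite_set exp_gt_zero ua]
  note pe = pot_elim[where W = W and \<omega> = \<omega> and u = ?u, OF a finite_set exp_gt_zero ua]
  have piv: "pivot_prod xs (schur a (schroedinger (insert a ?V) W \<omega> ?u)) = pivot_prod xs (schroedinger ?V ?W ?\<omega> u)"
    "pivot_form xs (schur a (schroedinger (insert a ?V) W \<omega> ?u)) (eliminate a (schroedinger (insert a ?V) W \<omega> ?u) z)
      = pivot_form xs (schroedinger ?V ?W ?\<omega> u) (field_elim a (exp v) W z)"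
    using el(2,3) H' by (intro pivots_cong; simp)+
  have pots: "(\<Sum>i\<in>insert a ?V. (\<alpha> i)\<^sup>2 * pot (insert a ?V) W \<omega> ?u i)
      = (\<alpha> a)\<^sup>2 * (exp v + W a a) + (\<Sum>i\<in>?V. (\<alpha> i)\<^sup>2 * pot ?V ?W ?\<omega> u i)"
  proof -
    have "(\<Sum>i\<in>?V. (\<alpha> i)\<^sup>2 * pot (insert a ?V) W \<omega> ?u i) = (\<Sum>i\<in>?V. (\<alpha> i)\<^sup>2 * pot ?V ?W ?\<omega> u i)"
      using pe(2) pot' by (intro sum.cong) simp_all
    then show ?thesis using a pe(1) by simp
  qed
  define P where "P = pivot_prod xs (schroedinger ?V ?W ?\<omega> u)"
  define S where "S = (\<Sum>i\<in>?V. (\<alpha> i)\<^sup>2 * pot ?V ?W ?\<omega> u i)"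
  define F where "F = pivot_form xs (schroedinger ?V ?W ?\<omega> u) (field_elim a (exp v) W z)"
  have half: "sqrt (exp v) = exp (v / 2)"
  proof (rule real_sqrt_unique)
    show "(exp (v / 2))\<^sup>2 = exp v"
      using exp_double[of "v / 2"] by simp
  qed simp
  have "- (A * (e + w) + S) / 2 - (Z * i + F) / 2 + v / 2 = v / 2 - A / 2 * (e + w) - Z / 2 * i + (- S / 2 - F / 2)"
    for A e w Z i :: real
    by (simp add: field_simps)
  then have "- ((\<alpha> a)\<^sup>2 * (exp v + W a a) + S) / 2 - ((z a)\<^sup>2 / exp v + F) / 2 + v / 2
      = v / 2 - (\<alpha> a)\<^sup>2 / 2 * (exp v + W a a) - (z a)\<^sup>2 / 2 * exp (- v) + (- S / 2 - F / 2)"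
    unfolding exp_minus divide_inverse[of _ "exp v"] .
  then have "exp (- ((\<alpha> a)\<^sup>2 * (exp v + W a a) + S) / 2 - ((z a)\<^sup>2 / exp v + F) / 2) * exp (v / 2)
      = exp (v / 2 - (\<alpha> a)\<^sup>2 / 2 * (exp v + W a a) - (z a)\<^sup>2 / 2 * exp (- v)) * exp (- S / 2 - F / 2)"
    unfolding mult_exp_exp by (simp only:)
  then show ?thesis
    unfolding reduced_density_def list.set pots pivot_prod.simps pivot_form.simps piv el(1)
      P_def[symmetric] S_def[symmetric] F_def[symmetric] real_sqrt_mult half
    by (simp only: mult_ac)
qed

lemma reduced_density_measurable:
  assumes "\<And>i. i \<in> set xs \<Longrightarrow> (\<lambda>x. u x i) \<in> borel_measurable N"
    and "\<And>i. i \<in> set xs \<Longrightarrow> (\<lambda>x. z x i) \<in> borel_measurable N"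
    and "\<And>i. i \<in> set xs \<Longrightarrow> (\<lambda>x. \<omega> x i) \<in> borel_measurable N"
    and "\<And>i j. i \<in> set xs \<Longrightarrow> j \<in> set xs \<Longrightarrow> (\<lambda>x. W x i j) \<in> borel_measurable N"
  shows "(\<lambda>x. reduced_density \<alpha> xs (W x) (\<omega> x) (z x) (u x)) \<in> borel_measurable N"
proof -
  let ?V = "set xs"
  have pot: "(\<lambda>x. pot ?V (W x) (\<omega> x) (u x) i) \<in> borel_measurable N" if "i \<in> ?V" for i
  proof -
    note [measurable] = assms(1)[OF that] assms(3)[OF that]
    have [measurable]: "(\<lambda>x. \<Sum>j\<in>?V. W x i j * exp (u x j)) \<in> borel_measurable N"
    proof (rule borel_measurable_sum)
      fix j assume "j \<in> ?V"
      note [measurable] = assms(1)[OF this] assms(4)[OF that this]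
      show "(\<lambda>x. W x i j * exp (u x j)) \<in> borel_measurable N" by measurable
    qed
    show ?thesis unfolding pot_def by measurable
  qed
  have H: "(\<lambda>x. schroedinger ?V (W x) (\<omega> x) (u x) i j) \<in> borel_measurable N" if "i \<in> ?V" "j \<in> ?V" for i j
  proof -
    note [measurable] = pot[OF that(1)] assms(4)[OF that]
    show ?thesis unfolding schroedinger_def by measurable
  qed
  note [measurable] = pivots_measurable[where M = "\<lambda>x. schroedinger ?V (W x) (\<omega> x) (u x)" and z = z, OF H assms(2)]
  have [measurable]: "(\<lambda>x. \<Sum>i\<in>?V. (\<alpha> i)\<^sup>2 * pot ?V (W x) (\<omega> x) (u x) i) \<in> borel_measurable N"
    using pot by (intro borel_measurable_sum borel_measurable_times) auto
  show ?thesis unfolding reduced_density_def by measurable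
qed

text \<open>The terms in \<open>1 / t\<close> depend on the weights at \<open>a\<close> only through \<open>B\<close>, and together with
  the term \<open>(z a)\<^sup>2 / t\<close> of the quadratic form they complete the square \<open>(B + z a)\<^sup>2 / t\<close>.\<close>

lemma effective_exponents:
  fixes \<alpha> :: "'v \<Rightarrow> real" and W :: "'v \<Rightarrow> 'v \<Rightarrow> real"
  assumes "finite V" and sym: "sym_on (insert a V) W"
  defines "B \<equiv> \<Sum>i\<in>V. \<alpha> i * W i a"
  shows "(\<Sum>i\<in>V. \<Sum>j\<in>V. \<alpha> i * \<alpha> j * weights_elim a t W i j) = (\<Sum>i\<in>V. \<Sum>j\<in>V. \<alpha> i * \<alpha> j * W i j) + B\<^sup>2 / t"
    and "(\<Sum>i\<in>V. \<alpha> i * field_elim a t W z i) = (\<Sum>i\<in>V. \<alpha> i * z i) + B * z a / t"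
    and "a \<notin> V \<Longrightarrow> (\<Sum>i\<in>insert a V. \<Sum>j\<in>insert a V. \<alpha> i * \<alpha> j * W i j)
      = (\<alpha> a)\<^sup>2 * W a a + 2 * \<alpha> a * B + (\<Sum>i\<in>V. \<Sum>j\<in>V. \<alpha> i * \<alpha> j * W i j)"
proof -
  have sy: "W a i = W i a" if "i \<in> V" for i
    using sym_onD[OF sym, of i a] that by simp
  have "(\<Sum>i\<in>V. \<Sum>j\<in>V. \<alpha> i * \<alpha> j * weights_elim a t W i j)
      = (\<Sum>i\<in>V. \<Sum>j\<in>V. \<alpha> i * \<alpha> j * W i j) + (\<Sum>i\<in>V. \<Sum>j\<in>V. (\<alpha> i * W i a) * (\<alpha> j * W j a)) / t"
    unfolding sum.distrib[symmetric] sum_divide_distrib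
    by (intro sum.cong refl) (simp add: weights_elim_def sy field_simps)
  also have "(\<Sum>i\<in>V. \<Sum>j\<in>V. (\<alpha> i * W i a) * (\<alpha> j * W j a)) = B\<^sup>2"
    by (simp add: B_def power2_eq_square sum_product)
  finally show "(\<Sum>i\<in>V. \<Sum>j\<in>V. \<alpha> i * \<alpha> j * weights_elim a t W i j) = (\<Sum>i\<in>V. \<Sum>j\<in>V. \<alpha> i * \<alpha> j * W i j) + B\<^sup>2 / t" .
  show "(\<Sum>i\<in>V. \<alpha> i * field_elim a t W z i) = (\<Sum>i\<in>V. \<alpha> i * z i) + B * z a / t"
    unfolding B_def sum_distrib_right sum_divide_distrib sum.distrib[symmetric]
    by (intro sum.cong refl) (simp add: field_elim_def distrib_left mult.assoc)
  show "(\<Sum>i\<in>insert a V. \<Sum>j\<in>insert a V. \<alpha> i * \<alpha> j * W i j)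
      = (\<alpha> a)\<^sup>2 * W a a + 2 * \<alpha> a * B + (\<Sum>i\<in>V. \<Sum>j\<in>V. \<alpha> i * \<alpha> j * W i j)" if "a \<notin> V"
  proof -
    have "(\<Sum>j\<in>V. \<alpha> a * \<alpha> j * W a j) = \<alpha> a * B" "(\<Sum>i\<in>V. \<alpha> i * \<alpha> a * W i a) = \<alpha> a * B"
      by (simp_all add: B_def sum_distrib_left sy mult_ac)
    then show ?thesis
      using that assms(1) by (simp add: sum.distrib power2_eq_square)
  qed
qed

text \<open>Induction on the number of vertices.  After the change of variable from \<open>u a\<close> to \<open>v\<close> and an exchange of the order of
  integration, the induction hypothesis for the reduced graph (whose weights depend on \<open>v\<close>) evaluates the inner
  integral, and the outer one is a Bessel integral of order one half.  The result does not involve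
  \<open>\<omega>\<close>: this is why \<open>\<theta>\<close>, which shifts only \<open>z\<close>, enters the final formula in such a simple way.\<close>

lemma nn_integral_reduced_density:
  assumes "distinct xs" "pinned (set xs) W \<omega>"
    and "\<And>i. i \<in> set xs \<Longrightarrow> \<omega> i \<le> z i" and "\<And>i. i \<in> set xs \<Longrightarrow> \<alpha> i > 0"
  shows "(\<integral>\<^sup>+u. ennreal (reduced_density \<alpha> xs W \<omega> z u) \<partial>Pi\<^sub>M (set xs) (\<lambda>_. lborel))
    = ennreal (sqrt (2 * pi) ^ length xs *
        exp (- (\<Sum>i\<in>set xs. \<Sum>j\<in>set xs. \<alpha> i * \<alpha> j * W i j) / 2 - (\<Sum>i\<in>set xs. \<alpha> i * z i)) /
        (\<Prod>i\<in>set xs. \<alpha> i))"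
  using assms
proof (induction xs arbitrary: W \<omega> z)
  case Nil
  then show ?case
    by (simp add: PiM_empty nn_integral_count_space_finite reduced_density_def)
next
  case (Cons a xs)
  let ?V = "set xs" and ?P = "Pi\<^sub>M (set xs) (\<lambda>_. lborel :: real measure)"
  let ?W = "\<lambda>v. weights_elim a (exp v) W" and ?f = "\<lambda>v. field_elim a (exp v) W"
  let ?R = "\<lambda>v u. reduced_density \<alpha> xs (?W v) (?f v \<omega>) (?f v z) u"
  define D where "D = (\<Prod>i\<in>?V. \<alpha> i)"
  define B where "B = (\<Sum>i\<in>?V. \<alpha> i * W i a)"
  define Q where "Q = (\<Sum>i\<in>?V. \<Sum>j\<in>?V. \<alpha> i * \<alpha> j * W i j)"
  define Z where "Z = (\<Sum>i\<in>?V. \<alpha> i * z i)"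
  define h where "h = (\<lambda>v. exp (v / 2 - (\<alpha> a)\<^sup>2 / 2 * (exp v + W a a) - (z a)\<^sup>2 / 2 * exp (- v)))"
  define K where "K = (\<lambda>u. (\<Sum>j\<in>?V. W a j * exp (u j)) + \<omega> a)"
  from Cons.prems have a: "a \<notin> ?V" and d: "distinct xs" and p: "pinned (insert a ?V) W \<omega>"
    and \<alpha>: "\<And>i. i \<in> insert a ?V \<Longrightarrow> \<alpha> i > 0" and z: "\<And>i. i \<in> insert a ?V \<Longrightarrow> \<omega> i \<le> z i" by auto
  have sym: "sym_on (insert a ?V) W" and W: "\<And>i j. i \<in> insert a ?V \<Longrightarrow> j \<in> insert a ?V \<Longrightarrow> W i j \<ge> 0"
    and \<omega>: "\<And>i. i \<in> insert a ?V \<Longrightarrow> \<omega> i \<ge> 0"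
    using p by (auto simp: pinned_def)
  have D: "D > 0" unfolding D_def using \<alpha> by (intro prod_pos) auto
  have [measurable]: "h \<in> borel_measurable borel" by (simp add: h_def)
  have [measurable]: "K \<in> borel_measurable ?P"
    unfolding K_def by measurable
  have R_meas: "(\<lambda>x. ?R (fst x) (snd x)) \<in> borel_measurable (lborel \<Otimes>\<^sub>M ?P)"
    by (intro reduced_density_measurable) (auto simp: weights_elim_def field_elim_def)
  have full_meas: "(\<lambda>u. reduced_density \<alpha> (a # xs) W \<omega> z u) \<in> borel_measurable (Pi\<^sub>M (insert a ?V) (\<lambda>_. lborel))"
    by (intro reduced_density_measurable) auto
  have IH: "(\<integral>\<^sup>+u. ennreal (?R v u) \<partial>?P)
    = ennreal (sqrt (2 * pi) ^ length xs * exp (- (Q + B\<^sup>2 / exp v) / 2 - (Z + B * z a / exp v)) / D)" for v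
  proof -
    have "?f v \<omega> i \<le> ?f v z i" if "i \<in> ?V" for i
      using z[of i] z[of a] W[of i a] that
      by (auto simp: field_elim_def intro!: add_mono divide_right_mono mult_left_mono)
    then show ?thesis
      using Cons.IH[OF d pinned_elim[OF p a exp_gt_zero]] \<alpha>
      by (simp add: effective_exponents(1,2)[OF _ sym] D_def B_def Q_def Z_def)
  qed
  have "(\<integral>\<^sup>+u. ennreal (reduced_density \<alpha> (a # xs) W \<omega> z u) \<partial>Pi\<^sub>M (insert a ?V) (\<lambda>_. lborel))
    = (\<integral>\<^sup>+u. (\<integral>\<^sup>+y. ennreal (reduced_density \<alpha> (a # xs) W \<omega> z (u(a := y))) \<partial>lborel) \<partial>?P)"
    using a full_meas by (intro lborel_product.product_nn_integral_insert) auto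
  also have "\<dots> = (\<integral>\<^sup>+u. (\<integral>\<^sup>+v. ennreal (h v) * ennreal (?R v u) \<partial>lborel) \<partial>?P)"
  proof (rule nn_integral_cong)
    fix u assume u: "u \<in> space ?P"
    have "(\<lambda>y. reduced_density \<alpha> (a # xs) W \<omega> z (u(a := y))) \<in> borel_measurable borel"
      by (intro reduced_density_measurable) auto
    then have "(\<integral>\<^sup>+y. ennreal (reduced_density \<alpha> (a # xs) W \<omega> z (u(a := y))) \<partial>lborel)
      = (\<integral>\<^sup>+v. ennreal (reduced_density \<alpha> (a # xs) W \<omega> z (u(a := ln (K u) - v))) \<partial>lborel)"
      by (subst nn_integral_real_affine[where c = "-1" and t = "ln (K u)"]) simp_all
    also have "\<dots> = (\<integral>\<^sup>+v. ennreal (h v) * ennreal (?R v u) \<partial>lborel)"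
      using reduced_density_elim[OF a p, of "K u" u \<alpha> z]
      by (simp add: h_def K_def ennreal_mult')
    finally show "(\<integral>\<^sup>+y. ennreal (reduced_density \<alpha> (a # xs) W \<omega> z (u(a := y))) \<partial>lborel)
      = (\<integral>\<^sup>+v. ennreal (h v) * ennreal (?R v u) \<partial>lborel)" .
  qed
  also have "\<dots> = (\<integral>\<^sup>+v. (\<integral>\<^sup>+u. ennreal (h v) * ennreal (?R v u) \<partial>?P) \<partial>lborel)"
  proof (rule pair_sigma_finite.Fubini')
    show "pair_sigma_finite (lborel :: real measure) ?P"
      by (intro pair_sigma_finite.intro lborel_product.sigma_finite lborel.sigma_finite_measure_axioms) simp
    note [measurable] = R_meas
    show "(\<lambda>(v, u). ennreal (h v) * ennreal (?R v u)) \<in> borel_measurable (lborel \<Otimes>\<^sub>M ?P)"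
      unfolding case_prod_beta by measurable
  qed
  also have "\<dots> = (\<integral>\<^sup>+v. ennreal (h v) * (\<integral>\<^sup>+u. ennreal (?R v u) \<partial>?P) \<partial>lborel)"
  proof (rule nn_integral_cong)
    fix v :: real
    have [measurable]: "?R v \<in> borel_measurable ?P"
      by (intro reduced_density_measurable) auto
    show "(\<integral>\<^sup>+u. ennreal (h v) * ennreal (?R v u) \<partial>?P) = ennreal (h v) * (\<integral>\<^sup>+u. ennreal (?R v u) \<partial>?P)"
      by (intro nn_integral_cmult) simp
  qed
  also have "\<dots> = (\<integral>\<^sup>+v. ennreal (sqrt (2 * pi) ^ length xs * exp (- ((\<alpha> a)\<^sup>2 * W a a + Q) / 2 - Z) / D) *
      ennreal (exp (v / 2 - (\<alpha> a)\<^sup>2 / 2 * exp v - (B + z a)\<^sup>2 / 2 * exp (- v))) \<partial>lborel)"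
  proof (rule nn_integral_cong)
    fix v :: real
    have "h v * exp (- (Q + B\<^sup>2 / exp v) / 2 - (Z + B * z a / exp v))
        = exp (- ((\<alpha> a)\<^sup>2 * W a a + Q) / 2 - Z) * exp (v / 2 - (\<alpha> a)\<^sup>2 / 2 * exp v - (B + z a)\<^sup>2 / 2 * exp (- v))"
      unfolding h_def mult_exp_exp
      by (simp add: exp_minus field_simps power2_eq_square)
    then have "h v * (sqrt (2 * pi) ^ length xs * exp (- (Q + B\<^sup>2 / exp v) / 2 - (Z + B * z a / exp v)) / D)
        = (sqrt (2 * pi) ^ length xs * exp (- ((\<alpha> a)\<^sup>2 * W a a + Q) / 2 - Z) / D) *
          exp (v / 2 - (\<alpha> a)\<^sup>2 / 2 * exp v - (B + z a)\<^sup>2 / 2 * exp (- v))"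
      by simp
    then show "ennreal (h v) * (\<integral>\<^sup>+u. ennreal (?R v u) \<partial>?P)
        = ennreal (sqrt (2 * pi) ^ length xs * exp (- ((\<alpha> a)\<^sup>2 * W a a + Q) / 2 - Z) / D) *
      ennreal (exp (v / 2 - (\<alpha> a)\<^sup>2 / 2 * exp v - (B + z a)\<^sup>2 / 2 * exp (- v)))"
      unfolding IH using D by (subst (1 2) ennreal_mult'[symmetric]) (auto simp: h_def)
  qed
  also have "\<dots> = ennreal (sqrt (2 * pi) ^ length xs * exp (- ((\<alpha> a)\<^sup>2 * W a a + Q) / 2 - Z) / D) *
      ennreal (sqrt (2 * pi) / \<alpha> a * exp (- \<alpha> a * (B + z a)))"
  proof -
    have "B + z a > 0"
    proof -
      \<comment> \<open>positivity of the outflow from \<open>a\<close>, at the field \<open>ln \<circ> \<alpha>\<close>\<close>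
      have "(\<Sum>j\<in>?V. W a j * exp (ln (\<alpha> j))) + \<omega> a > 0"
        using pinned_outflow_pos[OF p a] by simp
      also have "(\<Sum>j\<in>?V. W a j * exp (ln (\<alpha> j))) = B"
        unfolding B_def using \<alpha> sym_onD[OF sym, of a] by (intro sum.cong) (auto simp: mult.commute)
      finally show ?thesis using z[of a] by simp
    qed
    note bessel = nn_integral_half_bessel[OF \<alpha>[OF insertI1] this]
    show ?thesis
      unfolding bessel[symmetric] by (intro nn_integral_cmult) simp
  qed
  also have "\<dots> = ennreal (sqrt (2 * pi) ^ length (a # xs) *
        exp (- (\<Sum>i\<in>insert a ?V. \<Sum>j\<in>insert a ?V. \<alpha> i * \<alpha> j * W i j) / 2 - (\<Sum>i\<in>insert a ?V. \<alpha> i * z i)) /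
        (\<Prod>i\<in>insert a ?V. \<alpha> i))"
  proof -
    have "exp (- ((\<alpha> a)\<^sup>2 * W a a + Q) / 2 - Z) * exp (- \<alpha> a * (B + z a))
        = exp (- ((\<alpha> a)\<^sup>2 * W a a + 2 * \<alpha> a * B + Q) / 2 - (\<alpha> a * z a + Z))"
      unfolding mult_exp_exp by (simp add: field_simps)
    moreover have "(\<Prod>i\<in>insert a ?V. \<alpha> i) = \<alpha> a * D" "(\<Sum>i\<in>insert a ?V. \<alpha> i * z i) = \<alpha> a * z a + Z"
      using a by (simp_all add: D_def Z_def)
    moreover have "(\<Sum>i\<in>insert a ?V. \<Sum>j\<in>insert a ?V. \<alpha> i * \<alpha> j * W i j)
        = (\<alpha> a)\<^sup>2 * W a a + 2 * \<alpha> a * B + Q"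
      unfolding B_def Q_def using effective_exponents(3)[OF finite_set sym a] .
    ultimately show ?thesis
      using D \<alpha>[of a] by (subst ennreal_mult'[symmetric]) (auto simp: mult_ac)
  qed
  finally show ?case by simp
qed

section \<open>The weighted graph and its reference vertex\<close>

text \<open>Each undirected edge corresponds to two ordered pairs of vertices.\<close>

lemma prod_exp_on_edge:
  assumes g: "simple_graph Vt E"
    and sym: "\<And>i j. i \<in> Vt \<Longrightarrow> j \<in> Vt \<Longrightarrow> f i j = f j i"
    and supp: "\<And>i j. i \<in> Vt \<Longrightarrow> j \<in> Vt \<Longrightarrow> {i, j} \<notin> E \<Longrightarrow> f i j = 0"
  shows "(\<Prod>e\<in>E. on_edge (\<lambda>i j. exp (f i j)) e) = exp ((\<Sum>i\<in>Vt. \<Sum>j\<in>Vt. f i j) / 2)"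
proof -
  note fin = g[unfolded simple_graph_def, THEN conjunct1]
    and E = g[unfolded simple_graph_def, THEN conjunct2]
  have "E \<subseteq> Pow Vt"
  proof
    fix e assume "e \<in> E"
    with E obtain i j where "e = {i, j}" "i \<in> Vt" "j \<in> Vt" by blast
    then show "e \<in> Pow Vt" by simp
  qed
  then have finE: "finite E" using fin finite_subset by blast
  let ?A = "{p \<in> Vt \<times> Vt. {fst p, snd p} \<in> E}"
  have edge: "on_edge (\<lambda>i j. exp (f i j)) e = exp ((\<Sum>p | p \<in> ?A \<and> {fst p, snd p} = e. f (fst p) (snd p)) / 2)"
    if e: "e \<in> E" for e
  proof -
    obtain i j where ij: "e = {i, j}" "i \<in> Vt" "j \<in> Vt" "i \<noteq> j" using E e by blast
    have "p \<in> ?A \<and> {fst p, snd p} = e \<longleftrightarrow> p = (i, j) \<or> p = (j, i)" for p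
    proof (cases p)
      case (Pair a b)
      have eq: "{a, b} = {i, j} \<longleftrightarrow> a = i \<and> b = j \<or> a = j \<and> b = i"
        by (rule doubleton_eq_iff)
      have inA: "(a, b) \<in> ?A" if "{a, b} = {i, j}"
      proof -
        have "a \<in> Vt" "b \<in> Vt" using that ij(2,3) by (simp_all only: eq) (elim disjE; simp)+
        then show ?thesis using that e by (simp add: ij(1))
      qed
      show ?thesis
        unfolding Pair ij(1) prod.inject fst_conv snd_conv eq[symmetric]
        by (rule iffI, erule conjunct2, rule conjI, erule inA)
    qed
    then have "{p. p \<in> ?A \<and> {fst p, snd p} = e} = {(i, j), (j, i)}"
      by (simp only: set_eq_iff mem_Collect_eq insert_iff empty_iff simp_thms)
    then have "(\<Sum>p | p \<in> ?A \<and> {fst p, snd p} = e. f (fst p) (snd p)) = 2 * f i j"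
      using ij sym[of i j] by simp
    then show ?thesis
      using ij(1) on_edge_eq[of "\<lambda>i j. exp (f i j)" i j] sym[OF ij(2,3)] by simp
  qed
  have "(\<Sum>i\<in>Vt. \<Sum>j\<in>Vt. f i j) = (\<Sum>p\<in>Vt \<times> Vt. f (fst p) (snd p))"
    by (simp add: sum.cartesian_product case_prod_beta)
  also have "\<dots> = (\<Sum>p\<in>?A. f (fst p) (snd p))"
  proof (intro sum.mono_neutral_right ballI)
    show "finite (Vt \<times> Vt)" using fin by simp
    show "?A \<subseteq> Vt \<times> Vt" by blast
    fix p assume "p \<in> Vt \<times> Vt - ?A"
    then show "f (fst p) (snd p) = 0"
      using supp[of "fst p" "snd p"] by (cases p) simp
  qed
  also have "\<dots> = (\<Sum>e\<in>E. \<Sum>p | p \<in> ?A \<and> {fst p, snd p} = e. f (fst p) (snd p))"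
    using fin finE by (intro sum.group[symmetric]) auto
  finally show ?thesis
    using edge finE by (simp add: exp_sum sum_divide_distrib)
qed

locale rooted_graph =
  fixes Vt :: "'v set" and E :: "'v set set" and W :: "'v \<Rightarrow> 'v \<Rightarrow> real" and \<delta> :: 'v
  assumes simple: "simple_graph Vt E" and conn: "connected_graph Vt E" and root: "\<delta> \<in> Vt"
    and weights: "edge_weights Vt E W"
begin

abbreviation "V \<equiv> Vt - {\<delta>}"

text \<open>The weights to \<open>\<delta>\<close>, in their role as pinning \<open>\<omega>\<close> of the graph on \<open>V\<close>.\<close>

definition root_weight :: "'v \<Rightarrow> real" where "root_weight i = W i \<delta>"

lemma finite_Vt: "finite Vt" and finite_V: "finite V"
  using simple by (auto simp: simple_graph_def)

lemma edge_subset: "e \<in> E \<Longrightarrow> e \<subseteq> Vt"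
proof -
  assume "e \<in> E"
  with simple[unfolded simple_graph_def, THEN conjunct2]
  obtain i j where "e = {i, j}" "i \<in> Vt" "j \<in> Vt" by blast
  then show ?thesis by simp
qed

lemma sum_Vt: "(\<Sum>i\<in>Vt. f i) = f \<delta> + (\<Sum>i\<in>V. f i)" for f :: "'v \<Rightarrow> real"
  using finite_Vt root by (rule sum.remove)

lemma W_sym: "i \<in> Vt \<Longrightarrow> j \<in> Vt \<Longrightarrow> W i j = W j i"
  and W_off: "i \<in> Vt \<Longrightarrow> j \<in> Vt \<Longrightarrow> {i, j} \<notin> E \<Longrightarrow> W i j = 0"
  and W_edge: "i \<in> Vt \<Longrightarrow> j \<in> Vt \<Longrightarrow> {i, j} \<in> E \<Longrightarrow> W i j > 0"
  using weights by (auto simp: edge_weights_def)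

lemma W_nonneg: "i \<in> Vt \<Longrightarrow> j \<in> Vt \<Longrightarrow> W i j \<ge> 0"
  using W_off[of i j] W_edge[of i j] by fastforce

lemma W_diag: "i \<in> Vt \<Longrightarrow> W i i = 0"
proof -
  assume i: "i \<in> Vt"
  have "{i, i} \<notin> E"
    using simple by (auto simp: simple_graph_def doubleton_eq_iff)
  then show ?thesis using W_off[OF i i] by simp
qed

text \<open>A path from a vertex of \<open>S\<close> to \<open>\<delta>\<close> has to leave \<open>S\<close> along some edge.\<close>

lemma pinned_V: "pinned V W root_weight"
  unfolding pinned_def
proof (intro conjI ballI allI impI)
  show "sym_on V W" using W_sym by (auto simp: sym_on_def)
  show "W i j \<ge> 0" if "i \<in> V" "j \<in> V" for i j using W_nonneg that by auto
  show "root_weight i \<ge> 0" if "i \<in> V" for i using W_nonneg root that by (auto simp: root_weight_def)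
  fix S assume S: "S \<subseteq> V" "S \<noteq> {}"
  show "\<exists>i\<in>S. root_weight i > 0 \<or> (\<exists>j\<in>V - S. W i j > 0)"
  proof (rule ccontr)
    assume *: "\<not> ?thesis"
    obtain i where i: "i \<in> S" using S by auto
    have "(i, \<delta>) \<in> {(a, b). {a, b} \<in> E}\<^sup>*"
      using conn i S root by (auto simp: connected_graph_def)
    then have "\<delta> \<in> S"
    proof (induction rule: rtrancl_induct)
      case (step y z)
      have yz: "{y, z} \<in> E" using step by simp
      then have "{y, z} \<subseteq> Vt"
        by (rule edge_subset)
      then have "W y z > 0" using W_edge yz by simp
      then show "z \<in> S"
        using * step.IH \<open>{y, z} \<subseteq> Vt\<close> by (cases "z = \<delta>") (auto simp: root_weight_def)
    qed (rule i)
    then show False using S by auto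
  qed
qed

abbreviation "H u \<equiv> schroedinger V W root_weight u"

lemma H_sym: "sym_on V (H u)"
  using W_sym by (auto simp: sym_on_def schroedinger_def)

lemma pot_root:
  assumes "u \<delta> = 0"
  shows "pot V W root_weight u i = (\<Sum>j\<in>Vt. W i j * exp (u j - u i))"
proof -
  have "(\<Sum>j\<in>Vt. W i j * exp (u j - u i)) = exp (- u i) * (\<Sum>j\<in>Vt. W i j * exp (u j))"
    by (simp add: sum_distrib_left exp_diff exp_minus divide_inverse mult_ac)
  then show ?thesis
    using assms by (simp add: pot_def sum_Vt root_weight_def add.commute)
qed

lemma beta_eq:
  assumes "u \<delta> = 0" "i \<in> V"
  shows "beta Vt E W u i = pot V W root_weight u i / 2"
proof -
  have "(\<Sum>j | j \<in> Vt \<and> {i, j} \<in> E. W i j * exp (u j - u i)) = (\<Sum>j\<in>Vt. W i j * exp (u j - u i))"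
    using assms W_off finite_Vt by (intro sum.mono_neutral_left) auto
  then show ?thesis
    using assms by (simp add: beta_def pot_root)
qed

lemma A_mat_eq:
  assumes u: "u \<delta> = 0" and i: "i \<in> V" "j \<in> V"
  shows "A_mat Vt W u i j = exp (u i) * H u i j * exp (u j)"
proof (cases "i = j")
  case True
  have "A_mat Vt W u i i = exp (u i) * (\<Sum>k\<in>Vt. W i k * exp (u k))"
    by (simp add: A_mat_def sum_distrib_left exp_add mult_ac)
  also have "(\<Sum>k\<in>Vt. W i k * exp (u k)) = pot V W root_weight u i * exp (u i)"
    using u by (simp add: pot_def sum_Vt root_weight_def exp_minus field_simps)
  finally show ?thesis
    using True i W_diag by (simp add: schroedinger_def)
qed (simp add: A_mat_def schroedinger_def exp_add)

text \<open>By symmetry each hyperbolic cosine may be replaced by one of its two exponentials; the sum over \<open>j\<close> is then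
  a potential if \<open>i \<in> V\<close>, and it is the interaction with the pinning if \<open>i = \<delta>\<close>.\<close>

lemma cosh_sum:
  assumes u: "u \<delta> = 0"
  shows "(\<Sum>i\<in>Vt. \<Sum>j\<in>Vt. W i j * cosh (u i - u j))
    = (\<Sum>i\<in>V. pot V W root_weight u i) + (\<Sum>i\<in>V. root_weight i * exp (u i))"
proof -
  let ?e = "\<lambda>i j. W i j * exp (u j - u i)"
  have "(\<Sum>i\<in>Vt. \<Sum>j\<in>Vt. W i j * cosh (u i - u j)) = (\<Sum>i\<in>Vt. \<Sum>j\<in>Vt. ?e i j / 2 + ?e j i / 2)"
  proof (intro sum.cong refl)
    fix i j assume "i \<in> Vt" "j \<in> Vt"
    then show "W i j * cosh (u i - u j) = ?e i j / 2 + ?e j i / 2"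
      using W_sym[of i j] by (simp add: cosh_def algebra_simps)
  qed
  also have "\<dots> = (\<Sum>i\<in>Vt. \<Sum>j\<in>Vt. ?e i j / 2) + (\<Sum>i\<in>Vt. \<Sum>j\<in>Vt. ?e j i / 2)"
    by (simp only: sum.distrib)
  also have "(\<Sum>i\<in>Vt. \<Sum>j\<in>Vt. ?e j i / 2) = (\<Sum>i\<in>Vt. \<Sum>j\<in>Vt. ?e i j / 2)"
    by (rule sum.swap)
  also have "(\<Sum>i\<in>Vt. \<Sum>j\<in>Vt. ?e i j / 2) + (\<Sum>i\<in>Vt. \<Sum>j\<in>Vt. ?e i j / 2) = (\<Sum>i\<in>Vt. \<Sum>j\<in>Vt. ?e i j)"
    by (simp add: sum_divide_distrib[symmetric])
  also have "\<dots> = (\<Sum>j\<in>Vt. ?e \<delta> j) + (\<Sum>i\<in>V. pot V W root_weight u i)"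
    using u by (simp add: sum_Vt[of "\<lambda>i. \<Sum>j\<in>Vt. ?e i j"] pot_root)
  also have "(\<Sum>j\<in>Vt. ?e \<delta> j) = (\<Sum>j\<in>V. root_weight j * exp (u j))"
  proof -
    have "(\<Sum>j\<in>V. ?e \<delta> j) = (\<Sum>j\<in>V. root_weight j * exp (u j))"
      using u W_sym[OF root] by (intro sum.cong) (auto simp: root_weight_def)
    then show ?thesis
      using W_diag[OF root] by (simp add: sum_Vt)
  qed
  finally show ?thesis by simp
qed

lemma edge_factor:
  assumes u: "u \<delta> = 0"
  shows "(\<Prod>e\<in>E. on_edge (\<lambda>i j. exp (- W i j * (cosh (u i - u j) - 1))) e)
    = exp ((\<Sum>i\<in>Vt. \<Sum>j\<in>Vt. W i j) / 2
        - (\<Sum>i\<in>V. pot V W root_weight u i) / 2 - (\<Sum>i\<in>V. root_weight i * exp (u i)) / 2)"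
proof -
  have sym: "- W i j * (cosh (u i - u j) - 1) = - W j i * (cosh (u j - u i) - 1)" if "i \<in> Vt" "j \<in> Vt" for i j
    using W_sym[OF that] cosh_minus[of "u i - u j"] by simp
  have "(\<Sum>i\<in>Vt. \<Sum>j\<in>Vt. - W i j * (cosh (u i - u j) - 1))
      = (\<Sum>i\<in>Vt. \<Sum>j\<in>Vt. W i j) - (\<Sum>i\<in>Vt. \<Sum>j\<in>Vt. W i j * cosh (u i - u j))"
    by (simp add: sum_subtractf[symmetric] algebra_simps)
  then show ?thesis
    using W_off by (subst prod_exp_on_edge[OF simple sym]) (auto simp: cosh_sum[where u = u, OF u] diff_divide_distrib add_divide_distrib)
qed

end

text \<open>An order of elimination is fixed for the vertices in \<open>V\<close>.\<close>

locale listed_rooted_graph = rooted_graph Vt E W \<delta>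
  for Vt :: "'v set" and E W \<delta> +
  fixes xs :: "'v list"
  assumes xs: "distinct xs" "set xs = V"
begin

lemma H_pivots: "pivots_pos xs (H u)"
  using pivots_pos_schroedinger[OF xs(1), of W root_weight u] pinned_V xs(2) by simp

lemma A_pivots:
  assumes "u \<delta> = 0"
  shows "pivots_pos xs (A_mat Vt W u)"
proof -
  have "pivots_pos xs (A_mat Vt W u) \<longleftrightarrow> pivots_pos xs (\<lambda>i j. exp (u i) * H u i j * exp (u j))"
    using A_mat_eq[where u = u, OF assms] xs(2) by (intro pivots_cong(1)[where y = "\<lambda>_. 0" and z = "\<lambda>_. 0"]) auto
  then show ?thesis using pivots_pos_scale[OF _ H_pivots, of "\<lambda>i. exp (u i)" u] by simp
qed

lemma A_sym:
  assumes "u \<delta> = 0"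
  shows "sym_on V (A_mat Vt W u)"
  using sym_onD[OF H_sym] A_mat_eq[where u = u, OF assms] by (simp add: sym_on_def)

lemma A_det:
  assumes "u \<delta> = 0"
  shows "det_on V (A_mat Vt W u) = (\<Prod>i\<in>V. exp (u i))\<^sup>2 * pivot_prod xs (H u)"
proof -
  have "det_on V (A_mat Vt W u) = det_on V (\<lambda>i j. exp (u i) * H u i j * exp (u j))"
    using A_mat_eq[where u = u, OF assms] by (intro det_on_cong) auto
  then show ?thesis
    using pivot_prod_eq_det_on[OF xs(1) H_pivots, of u] xs(2) by (simp add: det_on_scale[OF finite_V])
qed

lemma green_eq:
  assumes u: "u \<delta> = 0" and i: "i \<in> V" "j \<in> V"
  shows "green Vt W \<delta> u i j = inv_on V (H u) i j"
proof -
  let ?N = "inv_on V (H u)"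
  let ?M = "\<lambda>i j. exp (- u i) * ?N i j * exp (- u j)"
  have N: "is_inverse_on V (H u) ?N"
    using pivots_pos_inverse[OF xs(1) H_pivots, of u] H_sym xs(2) by simp
  have "is_inverse_on V (A_mat Vt W u) ?M"
    unfolding is_inverse_on_def
  proof (intro conjI ballI)
    fix i j assume ij: "i \<in> V" "j \<in> V"
    have "(\<Sum>k\<in>V. A_mat Vt W u i k * ?M k j) = exp (u i) * (\<Sum>k\<in>V. H u i k * ?N k j) * exp (- u j)"
      unfolding sum_distrib_left sum_distrib_right
      using ij by (intro sum.cong) (simp_all add: A_mat_eq[where u = u, OF u] exp_minus)
    then show "(\<Sum>k\<in>V. A_mat Vt W u i k * ?M k j) = (if i = j then 1 else 0)"
      using N ij by (simp add: is_inverse_on_def exp_minus)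
    have "(\<Sum>k\<in>V. ?M i k * A_mat Vt W u k j) = exp (- u i) * (\<Sum>k\<in>V. ?N i k * H u k j) * exp (u j)"
      unfolding sum_distrib_left sum_distrib_right
      using ij by (intro sum.cong) (simp_all add: A_mat_eq[where u = u, OF u] exp_minus)
    then show "(\<Sum>k\<in>V. ?M i k * A_mat Vt W u k j) = (if i = j then 1 else 0)"
      using N ij by (simp add: is_inverse_on_def exp_minus)
  qed
  then have "inv_on V (A_mat Vt W u) i j = ?M i j"
    using inv_on_unique[OF finite_V _ i] by blast
  then show ?thesis
    using i by (simp add: green_def exp_minus)
qed

text \<open>The field \<open>u\<close> is recovered from the operator by \<open>H e\<^sup>u = \<omega>\<close>.\<close>

lemma H_exp: "i \<in> V \<Longrightarrow> (\<Sum>j\<in>V. H u i j * exp (u j)) = root_weight i"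
proof -
  assume i: "i \<in> V"
  have "(\<Sum>j\<in>V. H u i j * exp (u j))
      = (\<Sum>j\<in>V. (if i = j then pot V W root_weight u i * exp (u j) else 0) - W i j * exp (u j))"
    by (intro sum.cong) (auto simp: schroedinger_def left_diff_distrib)
  also have "\<dots> = pot V W root_weight u i * exp (u i) - (\<Sum>j\<in>V. W i j * exp (u j))"
    using i finite_V by (simp add: sum_subtractf)
  also have "\<dots> = root_weight i"
    by (simp add: pot_def exp_minus field_simps)
  finally show ?thesis .
qed

text \<open>Writing \<open>y\<close> for the solution of \<open>H y = - \<theta>\<close>, the solution for the right hand side \<open>\<omega> - \<theta>\<close> is \<open>e\<^sup>u + y\<close>.  Expanding the
  quadratic form shows that the terms linear and quadratic in \<open>\<theta>\<close> and the interaction with \<open>\<delta>\<close>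
  combine into \<open>(\<omega> - \<theta>)\<^sup>t H\<^sup>-\<^sup>1 (\<omega> - \<theta>)\<close>.\<close>

lemma green_form:
  assumes u: "u \<delta> = 0"
  shows "inner_on Vt \<theta> (mult_vec_on Vt (green Vt W \<delta> u) \<theta>) = pivot_form xs (H u) (\<lambda>i. - \<theta> i)"
    and "pivot_form xs (H u) (\<lambda>i. root_weight i - \<theta> i)
      = pivot_form xs (H u) (\<lambda>i. - \<theta> i) - 2 * (\<Sum>i\<in>V. \<theta> i * exp (u i)) + (\<Sum>i\<in>V. root_weight i * exp (u i))"
proof -
  define y where "y = (\<lambda>i. - (\<Sum>j\<in>V. inv_on V (H u) i j * \<theta> j))"
  have N: "is_inverse_on V (H u) (inv_on V (H u))"
    using pivots_pos_inverse[OF xs(1) H_pivots, of u] H_sym xs(2) by simp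
  have y: "(\<Sum>j\<in>V. H u i j * y j) = - \<theta> i" if i: "i \<in> V" for i
  proof -
    have "(\<Sum>j\<in>V. H u i j * y j) = - (\<Sum>k\<in>V. (\<Sum>j\<in>V. H u i j * inv_on V (H u) j k) * \<theta> k)"
      by (simp add: y_def sum_negf sum_distrib_left sum_distrib_right mult.assoc) (rule sum.swap)
    also have "(\<Sum>k\<in>V. (\<Sum>j\<in>V. H u i j * inv_on V (H u) j k) * \<theta> k) = (\<Sum>k\<in>V. if i = k then \<theta> k else 0)"
      using N i by (intro sum.cong) (auto simp: is_inverse_on_def)
    finally show ?thesis using i finite_V by simp
  qed
  have form: "pivot_form xs (H u) z = (\<Sum>i\<in>V. z i * x i)" if "\<And>i. i \<in> V \<Longrightarrow> (\<Sum>j\<in>V. H u i j * x j) = z i" for x z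
    using pivot_form_eq[OF xs(1) H_pivots, of u x z] H_sym that xs(2) by simp
  have fy: "pivot_form xs (H u) (\<lambda>i. - \<theta> i) = (\<Sum>i\<in>V. - \<theta> i * y i)"
    by (intro form y)
  have g0: "green Vt W \<delta> u i \<delta> = 0" "green Vt W \<delta> u \<delta> i = 0" for i by (simp_all add: green_def)
  have "(\<Sum>j\<in>V. green Vt W \<delta> u i j * \<theta> j) = - y i" if "i \<in> V" for i
    using green_eq[where u = u, OF u that] by (simp add: y_def)
  then have "(\<Sum>i\<in>V. \<theta> i * (\<Sum>j\<in>V. green Vt W \<delta> u i j * \<theta> j)) = (\<Sum>i\<in>V. - \<theta> i * y i)"
    by (intro sum.cong) simp_all
  then show "inner_on Vt \<theta> (mult_vec_on Vt (green Vt W \<delta> u) \<theta>) = pivot_form xs (H u) (\<lambda>i. - \<theta> i)"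
    unfolding fy inner_on_def mult_vec_on_def by (simp add: sum_Vt g0)
  have "pivot_form xs (H u) (\<lambda>i. root_weight i - \<theta> i) = (\<Sum>i\<in>V. (root_weight i - \<theta> i) * (exp (u i) + y i))"
    by (intro form) (simp add: distrib_left sum.distrib H_exp y)
  also have "\<dots> = (\<Sum>i\<in>V. root_weight i * exp (u i)) + (\<Sum>i\<in>V. root_weight i * y i)
      - (\<Sum>i\<in>V. \<theta> i * exp (u i)) + (\<Sum>i\<in>V. - \<theta> i * y i)"
    by (simp add: algebra_simps sum.distrib sum_subtractf sum_negf)
  also have "(\<Sum>i\<in>V. root_weight i * y i) = (\<Sum>i\<in>V. \<Sum>j\<in>V. H u i j * exp (u j) * y i)"
    by (intro sum.cong refl) (simp only: sum_distrib_right[symmetric] H_exp)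
  also have "\<dots> = (\<Sum>j\<in>V. \<Sum>i\<in>V. H u i j * exp (u j) * y i)"
    by (rule sum.swap)
  also have "\<dots> = (\<Sum>j\<in>V. exp (u j) * (\<Sum>i\<in>V. H u j i * y i))"
    unfolding sum_distrib_left using sym_onD[OF H_sym[of u]] by (intro sum.cong refl) simp
  also have "\<dots> = - (\<Sum>j\<in>V. \<theta> j * exp (u j))"
    unfolding sum_negf[symmetric] by (intro sum.cong) (simp_all add: y)
  finally show "pivot_form xs (H u) (\<lambda>i. root_weight i - \<theta> i)
      = pivot_form xs (H u) (\<lambda>i. - \<theta> i) - 2 * (\<Sum>i\<in>V. \<theta> i * exp (u i)) + (\<Sum>i\<in>V. root_weight i * exp (u i))"
    unfolding fy by simp
qed

abbreviation "LV \<equiv> Pi\<^sub>M V (\<lambda>_. lborel :: real measure)"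

lemma extend_measurable:
  "(\<lambda>u. u(\<delta> := 0)) \<in> LV \<rightarrow>\<^sub>M restrict_space (Pi\<^sub>M Vt (\<lambda>_. borel)) (U_space Vt \<delta>)"
proof (rule measurable_restrict_space2)
  show ext: "(\<lambda>u. u(\<delta> := 0)) \<in> space LV \<rightarrow> U_space Vt \<delta>"
    using root by (auto simp: space_PiM U_space_def PiE_def extensional_def)
  have "(\<lambda>u i. (u(\<delta> := 0)) i) \<in> LV \<rightarrow>\<^sub>M Pi\<^sub>M Vt (\<lambda>_. borel)"
  proof (rule measurable_PiM_single')
    fix i assume "i \<in> Vt"
    then show "(\<lambda>u. (u(\<delta> := 0)) i) \<in> LV \<rightarrow>\<^sub>M borel"
      by (cases "i = \<delta>") simp_all
  qed (use root in \<open>auto simp: space_PiM PiE_def extensional_def\<close>)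
  then show "(\<lambda>u. u(\<delta> := 0)) \<in> LV \<rightarrow>\<^sub>M Pi\<^sub>M Vt (\<lambda>_. borel)" .
qed

lemma space_lebesgue_U: "space (lebesgue_U Vt \<delta>) = U_space Vt \<delta>"
  by (auto simp: lebesgue_U_def space_restrict_space space_PiM U_space_def)

lemma coordinate_measurable: "i \<in> Vt \<Longrightarrow> (\<lambda>u. u i) \<in> borel_measurable (lebesgue_U Vt \<delta>)"
  unfolding lebesgue_U_def by (simp add: measurable_restrict_space1)

lemma nn_integral_lebesgue_U:
  assumes "f \<in> borel_measurable (lebesgue_U Vt \<delta>)"
  shows "(\<integral>\<^sup>+u. f u \<partial>lebesgue_U Vt \<delta>) = (\<integral>\<^sup>+u. f (u(\<delta> := 0)) \<partial>LV)"
  using assms unfolding lebesgue_U_def by (subst nn_integral_distr[OF extend_measurable]) auto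

text \<open>Restriction to \<open>V\<close> undoes the extension by \<open>0\<close> and maps the measure back to Lebesgue measure.\<close>

lemma sigma_finite_lebesgue_U: "sigma_finite_measure (lebesgue_U Vt \<delta>)"
proof (rule sigma_finite_measure_distr)
  let ?r = "\<lambda>u. restrict u V :: 'v \<Rightarrow> real"
  show r: "?r \<in> lebesgue_U Vt \<delta> \<rightarrow>\<^sub>M LV"
    by (intro measurable_restrict) (use coordinate_measurable in auto)
  have "distr (lebesgue_U Vt \<delta>) LV ?r = distr LV LV (?r \<circ> (\<lambda>u. u(\<delta> := 0)))"
    using r unfolding lebesgue_U_def by (intro distr_distr extend_measurable) simp
  also have "\<dots> = distr LV LV (\<lambda>u. u)"
    by (intro distr_cong) (auto simp: space_PiM fun_eq_iff PiE_def extensional_def restrict_def)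
  also have "\<dots> = LV" by simp
  finally show "sigma_finite_measure (distr (lebesgue_U Vt \<delta>) LV ?r)"
    using lborel_product.sigma_finite[OF finite_V] by simp
qed

end

section \<open>The Laplace transform\<close>

context listed_rooted_graph
begin

text \<open>Outside \<open>Vt\<close> the coordinates are constant on the space of extensional functions.  Covering all indices
  removes side conditions from the measurability proofs below.\<close>

lemma coordinate_measurable_all [measurable]: "(\<lambda>u. u i) \<in> borel_measurable (lebesgue_U Vt \<delta>)"
proof (cases "i \<in> Vt")
  case False
  have "(\<lambda>u. u i) \<in> borel_measurable (lebesgue_U Vt \<delta>) \<longleftrightarrow>
      (\<lambda>u. undefined :: real) \<in> borel_measurable (lebesgue_U Vt \<delta>)"
    using False by (intro measurable_cong) (auto simp: space_lebesgue_U U_space_def PiE_def extensional_def)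
  then show ?thesis by simp
qed (rule coordinate_measurable)

lemma pot_measurable [measurable]: "(\<lambda>u. pot V W root_weight u i) \<in> borel_measurable (lebesgue_U Vt \<delta>)"
  unfolding pot_def by measurable

lemma A_mat_measurable [measurable]: "(\<lambda>u. A_mat Vt W u i j) \<in> borel_measurable (lebesgue_U Vt \<delta>)"
  unfolding A_mat_def by measurable

lemma det_A_measurable [measurable]: "(\<lambda>u. det_on V (A_mat Vt W u)) \<in> borel_measurable (lebesgue_U Vt \<delta>)"
  unfolding det_on_def by measurable

lemma pivot_form_measurable [measurable]: "(\<lambda>u. pivot_form xs (H u) z) \<in> borel_measurable (lebesgue_U Vt \<delta>)"
  by (rule pivots_measurable(2)) (simp_all add: schroedinger_def)

lemma reduced_density_extend:
  "reduced_density \<alpha> xs W root_weight z (u(\<delta> := 0)) = reduced_density \<alpha> xs W root_weight z u"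
proof -
  have pot: "pot V W root_weight (u(\<delta> := 0)) i = pot V W root_weight u i" if "i \<in> V" for i
    using that by (intro pot_cong) auto
  have H: "H (u(\<delta> := 0)) i j = H u i j" if "i \<in> V" for i j
    using pot[OF that] by (cases "i = j") (simp_all add: schroedinger_def)
  have "pivot_prod xs (H (u(\<delta> := 0))) = pivot_prod xs (H u)"
    "pivot_form xs (H (u(\<delta> := 0))) z = pivot_form xs (H u) z"
    using H xs(2) by (intro pivots_cong; simp)+
  moreover have "(\<Sum>i\<in>V. (\<alpha> i)\<^sup>2 * pot V W root_weight (u(\<delta> := 0)) i) = (\<Sum>i\<in>V. (\<alpha> i)\<^sup>2 * pot V W root_weight u i)"
    using pot by (intro sum.cong) simp_all
  ultimately show ?thesis
    by (simp add: reduced_density_def xs(2))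
qed

lemma H22_density_eq:
  assumes u: "u \<delta> = 0" and s: "s \<delta> = 0"
  shows "H22_density Vt E W \<delta> u s =
    exp (- 1 / 2 * (\<Sum>i\<in>V. \<Sum>j\<in>V. s i * A_mat Vt W u i j * s j)) *
    (det_on V (A_mat Vt W u) * (\<Prod>i\<in>V. exp (- u i) / (2 * pi)) *
     exp ((\<Sum>i\<in>Vt. \<Sum>j\<in>Vt. W i j) / 2 - (\<Sum>i\<in>V. pot V W root_weight u i) / 2
       - (\<Sum>i\<in>V. root_weight i * exp (u i)) / 2))"
proof -
  have "inner_on Vt s (mult_vec_on Vt (A_mat Vt W u) s) = (\<Sum>i\<in>V. \<Sum>j\<in>V. s i * A_mat Vt W u i j * s j)"
    using s by (simp add: inner_on_def mult_vec_on_def sum_Vt sum_distrib_left mult.assoc)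
  then show ?thesis
    unfolding H22_density_def edge_factor[where u = u, OF u] by (simp add: mult_ac)
qed

lemma observable_eq:
  assumes u: "u \<delta> = 0"
  shows "exp (inner_on Vt \<theta> (\<lambda>i. exp (u i)) - 1/2 * inner_on Vt \<theta> (mult_vec_on Vt (green Vt W \<delta> u) \<theta>)) *
      exp (- inner_on V l (beta Vt E W u))
    = exp (\<theta> \<delta> + (\<Sum>i\<in>V. \<theta> i * exp (u i)) - pivot_form xs (H u) (\<lambda>i. - \<theta> i) / 2
        - (\<Sum>i\<in>V. l i * pot V W root_weight u i) / 2)"
proof -
  have "inner_on V l (beta Vt E W u) = (\<Sum>i\<in>V. l i * pot V W root_weight u i) / 2"
    unfolding inner_on_def sum_divide_distrib using beta_eq[where u = u, OF u] by (intro sum.cong) simp_all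
  moreover have "inner_on Vt \<theta> (\<lambda>i. exp (u i)) = \<theta> \<delta> + (\<Sum>i\<in>V. \<theta> i * exp (u i))"
    using u by (simp add: inner_on_def sum_Vt)
  ultimately show ?thesis
    unfolding green_form(1)[where u = u, OF u] mult_exp_exp by simp
qed

text \<open>The last factor on the left is the value of the Gaussian integral over \<open>s\<close>.  It reduces the determinant to its square
  root, and \<open>A = e\<^sup>u H e\<^sup>u\<close> absorbs the factors \<open>e\<^sup>-\<^sup>u\<close>; the factor \<open>e\<^sup>-\<^sup>\<lambda>\<^sup>\<beta>\<close> turns the coefficient \<open>1\<close> of each \<open>\<beta>\<^sub>i\<close> into
  \<open>1 + \<lambda>\<^sub>i\<close>.\<close>

lemma density_after_s_integration:
  fixes \<theta> l u :: "'v \<Rightarrow> real"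
  assumes u: "u \<delta> = 0" and l: "\<And>i. i \<in> V \<Longrightarrow> l i > -1"
  defines "z \<equiv> \<lambda>i. root_weight i - \<theta> i" and "\<alpha> \<equiv> \<lambda>i. sqrt (1 + l i)"
  shows "det_on V (A_mat Vt W u) * (\<Prod>i\<in>V. exp (- u i) / (2 * pi)) *
     exp ((\<Sum>i\<in>Vt. \<Sum>j\<in>Vt. W i j) / 2 - (\<Sum>i\<in>V. pot V W root_weight u i) / 2
       - (\<Sum>i\<in>V. root_weight i * exp (u i)) / 2) *
     exp (\<theta> \<delta> + (\<Sum>i\<in>V. \<theta> i * exp (u i)) - pivot_form xs (H u) (\<lambda>i. - \<theta> i) / 2
        - (\<Sum>i\<in>V. l i * pot V W root_weight u i) / 2) *
     sqrt ((2 * pi) ^ length xs / pivot_prod xs (A_mat Vt W u))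
    = exp ((\<Sum>i\<in>Vt. \<Sum>j\<in>Vt. W i j) / 2 + \<theta> \<delta>) / sqrt (2 * pi) ^ length xs *
      reduced_density \<alpha> xs W root_weight z u"
proof -
  define T where "T = (\<Sum>i\<in>Vt. \<Sum>j\<in>Vt. W i j) / 2"
  define P where "P = pivot_prod xs (H u)"
  define p where "p = (\<Prod>i\<in>V. exp (u i))"
  define c where "c = sqrt (2 * pi) ^ length xs"
  have P: "P > 0" unfolding P_def by (rule pivot_prod_pos[OF H_pivots])
  have p: "p > 0" unfolding p_def by (intro prod_pos) simp
  have "c = sqrt ((2 * pi) ^ length xs)"
    unfolding c_def by (rule real_sqrt_power[symmetric])
  then have c: "c > 0" "c\<^sup>2 = (2 * pi) ^ length xs"
    by simp_all
  have len: "length xs = card V"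
    using distinct_card[OF xs(1)] xs(2) by simp
  have det: "det_on V (A_mat Vt W u) = p\<^sup>2 * P"
    unfolding p_def P_def by (rule A_det[where u = u, OF u])
  have piv: "pivot_prod xs (A_mat Vt W u) = p\<^sup>2 * P"
    using pivot_prod_eq_det_on[OF xs(1) A_pivots[where u = u, OF u]] det xs(2) by simp
  have prod: "(\<Prod>i\<in>V. exp (- u i) / (2 * pi)) = 1 / (p * c\<^sup>2)"
    by (simp add: prod_dividef c len p_def exp_minus prod_inversef inverse_eq_divide prod.distrib power_mult_distrib)
  have root: "sqrt ((2 * pi) ^ length xs / (p\<^sup>2 * P)) = c / (p * sqrt P)"
    unfolding c(2)[symmetric] real_sqrt_divide real_sqrt_mult using c(1) p by simp
  have "(sqrt P)\<^sup>2 = P" using P by simp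
  then have "p\<^sup>2 * P * (1 / (p * c\<^sup>2)) * (c / (p * sqrt P)) = sqrt P / c"
    using P p c(1) by (simp add: field_simps power2_eq_square)
  note pref = this
  have "(\<Sum>i\<in>V. (\<alpha> i)\<^sup>2 * pot V W root_weight u i)
      = (\<Sum>i\<in>V. pot V W root_weight u i) + (\<Sum>i\<in>V. l i * pot V W root_weight u i)"
    unfolding sum.distrib[symmetric]
  proof (intro sum.cong refl)
    fix i assume "i \<in> V"
    then have "(\<alpha> i)\<^sup>2 = 1 + l i" using l[of i] by (simp add: \<alpha>_def)
    then show "(\<alpha> i)\<^sup>2 * pot V W root_weight u i = pot V W root_weight u i + l i * pot V W root_weight u i"
      by (simp add: distrib_right)
  qed
  then have "exp (T - (\<Sum>i\<in>V. pot V W root_weight u i) / 2 - (\<Sum>i\<in>V. root_weight i * exp (u i)) / 2) *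
     exp (\<theta> \<delta> + (\<Sum>i\<in>V. \<theta> i * exp (u i)) - pivot_form xs (H u) (\<lambda>i. - \<theta> i) / 2
        - (\<Sum>i\<in>V. l i * pot V W root_weight u i) / 2)
    = exp (T + \<theta> \<delta>) * exp (- (\<Sum>i\<in>V. (\<alpha> i)\<^sup>2 * pot V W root_weight u i) / 2 - pivot_form xs (H u) z / 2)"
    unfolding mult_exp_exp z_def green_form(2)[where u = u, OF u] by (simp add: add_divide_distrib diff_divide_distrib)
  note expo = this
  have "p\<^sup>2 * P * (1 / (p * c\<^sup>2)) * e1 * e2 * (c / (p * sqrt P)) = (p\<^sup>2 * P * (1 / (p * c\<^sup>2)) * (c / (p * sqrt P))) * (e1 * e2)"
    for e1 e2 :: real by (simp only: mult_ac)
  then show ?thesis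
    unfolding det piv prod root T_def[symmetric] reduced_density_def xs(2) c_def[symmetric] P_def[symmetric]
    by (simp only: pref expo) simp
qed

lemma laplace_constant:
  fixes \<theta> l :: "'v \<Rightarrow> real"
  assumes l: "l \<in> Lambda_set Vt \<delta>"
  defines "\<alpha> \<equiv> \<lambda>i. sqrt (1 + l i)"
  shows "exp ((\<Sum>i\<in>Vt. \<Sum>j\<in>Vt. W i j) / 2 + \<theta> \<delta>) *
      (exp (- (\<Sum>i\<in>V. \<Sum>j\<in>V. \<alpha> i * \<alpha> j * W i j) / 2 - (\<Sum>i\<in>V. \<alpha> i * (root_weight i - \<theta> i))) / (\<Prod>i\<in>V. \<alpha> i))
    = L_fun Vt E W \<delta> l * exp (inner_on Vt \<theta> (\<lambda>i. sqrt (1 + l i)))"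
proof -
  have \<alpha>0: "\<alpha> \<delta> = 1" using l by (simp add: \<alpha>_def Lambda_set_def)
  let ?f = "\<lambda>i j. W i j * (1 - sqrt (1 + l i) * sqrt (1 + l j))"
  have "(\<Sum>i\<in>Vt. \<Sum>j\<in>Vt. ?f i j) = (\<Sum>i\<in>Vt. \<Sum>j\<in>Vt. W i j) - (\<Sum>i\<in>Vt. \<Sum>j\<in>Vt. \<alpha> i * \<alpha> j * W i j)"
    unfolding sum_subtractf[symmetric] by (intro sum.cong refl) (simp add: \<alpha>_def algebra_simps)
  also have "(\<Sum>i\<in>Vt. \<Sum>j\<in>Vt. \<alpha> i * \<alpha> j * W i j)
      = 2 * (\<Sum>i\<in>V. \<alpha> i * root_weight i) + (\<Sum>i\<in>V. \<Sum>j\<in>V. \<alpha> i * \<alpha> j * W i j)"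
  proof -
    have "(\<Sum>j\<in>V. \<alpha> j * W \<delta> j) = (\<Sum>i\<in>V. \<alpha> i * root_weight i)"
      using W_sym[OF root] by (intro sum.cong) (auto simp: root_weight_def)
    then show ?thesis
      by (simp add: sum_Vt \<alpha>0 sum.distrib W_diag[OF root] root_weight_def)
  qed
  finally have "(\<Sum>i\<in>Vt. \<Sum>j\<in>Vt. ?f i j) / 2 + (\<theta> \<delta> + (\<Sum>i\<in>V. \<theta> i * \<alpha> i))
      = (\<Sum>i\<in>Vt. \<Sum>j\<in>Vt. W i j) / 2 + \<theta> \<delta> + (- (\<Sum>i\<in>V. \<Sum>j\<in>V. \<alpha> i * \<alpha> j * W i j) / 2 -
        (\<Sum>i\<in>V. \<alpha> i * (root_weight i - \<theta> i)))"
    by (simp add: right_diff_distrib sum_subtractf diff_divide_distrib add_divide_distrib mult.commute)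
  note expo = this
  have "(\<Prod>e\<in>E. on_edge (\<lambda>i j. exp (?f i j)) e) = exp ((\<Sum>i\<in>Vt. \<Sum>j\<in>Vt. ?f i j) / 2)"
    by (rule prod_exp_on_edge[OF simple]) (simp_all add: W_sym W_off mult.commute)
  moreover have "inner_on Vt \<theta> (\<lambda>i. sqrt (1 + l i)) = \<theta> \<delta> + (\<Sum>i\<in>V. \<theta> i * \<alpha> i)"
    using \<alpha>0 by (simp add: inner_on_def sum_Vt \<alpha>_def)
  moreover have "(\<Prod>i\<in>V. 1 / sqrt (1 + l i)) = 1 / (\<Prod>i\<in>V. \<alpha> i)"
    by (simp add: \<alpha>_def prod_dividef)
  ultimately have "L_fun Vt E W \<delta> l * exp (inner_on Vt \<theta> (\<lambda>i. sqrt (1 + l i)))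
      = exp ((\<Sum>i\<in>Vt. \<Sum>j\<in>Vt. ?f i j) / 2) * exp (\<theta> \<delta> + (\<Sum>i\<in>V. \<theta> i * \<alpha> i)) / (\<Prod>i\<in>V. \<alpha> i)"
    by (simp add: L_fun_def)
  then show ?thesis
    unfolding mult_exp_exp expo by (simp add: mult_exp_exp)
qed

text \<open>Tonelli's theorem reduces the claim to the Gaussian integral over \<open>s\<close> followed by the integral of
  \<open>reduced_density\<close>.  As the integrand is nonnegative, the value obtained for the nonnegative integral is that of the
  Bochner integral.\<close>

lemma laplace_transform:
  assumes \<theta>: "\<forall>i\<in>Vt. \<theta> i \<le> 0" and l: "l \<in> Lambda_set Vt \<delta>"
  shows "(\<integral>(u, s).
            exp (inner_on Vt \<theta> (\<lambda>i. exp (u i))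
                 - 1/2 * inner_on Vt \<theta> (mult_vec_on Vt (green Vt W \<delta> u) \<theta>)) *
            exp (- inner_on V l (beta Vt E W u))
          \<partial>H22_measure Vt E W \<delta>)
       = L_fun Vt E W \<delta> l * exp (inner_on Vt \<theta> (\<lambda>i. sqrt (1 + l i)))"
    (is "(\<integral>(u, s). ?F u \<partial>_) = ?R")
proof -
  let ?L = "lebesgue_U Vt \<delta>"
  interpret L: sigma_finite_measure ?L by (rule sigma_finite_lebesgue_U)
  define z where "z = (\<lambda>i. root_weight i - \<theta> i)"
  define \<alpha> where "\<alpha> = (\<lambda>i. sqrt (1 + l i))"
  define C where "C = exp ((\<Sum>i\<in>Vt. \<Sum>j\<in>Vt. W i j) / 2 + \<theta> \<delta>) / sqrt (2 * pi) ^ length xs"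
  define q where "q = (\<lambda>u s. \<Sum>i\<in>V. \<Sum>j\<in>V. s i * A_mat Vt W u i j * s j)"
  define F where "F = (\<lambda>u. exp (\<theta> \<delta> + (\<Sum>i\<in>V. \<theta> i * exp (u i)) - pivot_form xs (H u) (\<lambda>i. - \<theta> i) / 2
        - (\<Sum>i\<in>V. l i * pot V W root_weight u i) / 2))"
  define g where "g = (\<lambda>u. det_on V (A_mat Vt W u) * (\<Prod>i\<in>V. exp (- u i) / (2 * pi)) *
     exp ((\<Sum>i\<in>Vt. \<Sum>j\<in>Vt. W i j) / 2 - (\<Sum>i\<in>V. pot V W root_weight u i) / 2
       - (\<Sum>i\<in>V. root_weight i * exp (u i)) / 2))"
  have lV: "l i > -1" if "i \<in> V" for i using l that by (simp add: Lambda_set_def)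
  have sp: "u \<delta> = 0" if "u \<in> space ?L" for u
    using that by (simp add: space_lebesgue_U U_space_def)
  have [measurable]: "F \<in> borel_measurable ?L" "g \<in> borel_measurable ?L"
    unfolding F_def g_def by measurable
  have [measurable]: "(\<lambda>x. q (fst x) (snd x)) \<in> borel_measurable (?L \<Otimes>\<^sub>M ?L)"
  proof -
    have [measurable]: "(\<lambda>x. snd x i) \<in> borel_measurable (?L \<Otimes>\<^sub>M ?L)"
      "(\<lambda>x. A_mat Vt W (fst x) i j) \<in> borel_measurable (?L \<Otimes>\<^sub>M ?L)" for i j
      using measurable_compose[OF measurable_snd coordinate_measurable_all]
        measurable_compose[OF measurable_fst A_mat_measurable] by simp_all
    show ?thesis unfolding q_def by measurable
  qed
  have [measurable]: "(\<lambda>x. F (fst x)) \<in> borel_measurable (?L \<Otimes>\<^sub>M ?L)" "(\<lambda>x. g (fst x)) \<in> borel_measurable (?L \<Otimes>\<^sub>M ?L)"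
    by measurable
  have F_eq: "?F u = F u" if "u \<in> space ?L" for u
    unfolding F_def by (rule observable_eq[where u = u, OF sp[OF that]])
  have dens_eq: "H22_density Vt E W \<delta> u s = exp (- 1 / 2 * q u s) * g u" if "u \<in> space ?L" "s \<in> space ?L" for u s
    unfolding q_def g_def by (rule H22_density_eq[where u = u and s = s, OF sp[OF that(1)] sp[OF that(2)]])
  have g_nonneg: "g u \<ge> 0" if "u \<in> space ?L" for u
  proof -
    have "det_on V (A_mat Vt W u) \<ge> 0"
      using A_det[where u = u, OF sp[OF that]] pivot_prod_pos[OF H_pivots, of u] by simp
    then show ?thesis by (simp add: g_def prod_nonneg)
  qed
  have dens_meas: "(\<lambda>(u, s). ennreal (H22_density Vt E W \<delta> u s)) \<in> borel_measurable (?L \<Otimes>\<^sub>M ?L)"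
  proof -
    have "(\<lambda>(u, s). ennreal (H22_density Vt E W \<delta> u s)) \<in> borel_measurable (?L \<Otimes>\<^sub>M ?L) \<longleftrightarrow>
        (\<lambda>x. ennreal (exp (- 1 / 2 * q (fst x) (snd x)) * g (fst x))) \<in> borel_measurable (?L \<Otimes>\<^sub>M ?L)"
      by (intro measurable_cong) (auto simp: space_pair_measure dens_eq)
    then show ?thesis by simp
  qed
  have F_meas: "(\<lambda>(u, s). ?F u) \<in> borel_measurable (?L \<Otimes>\<^sub>M ?L)"
  proof -
    have "(\<lambda>(u, s). ?F u) \<in> borel_measurable (?L \<Otimes>\<^sub>M ?L) \<longleftrightarrow> (\<lambda>x. F (fst x)) \<in> borel_measurable (?L \<Otimes>\<^sub>M ?L)"
    proof (rule measurable_cong)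
      fix x assume "x \<in> space (?L \<Otimes>\<^sub>M ?L)"
      then have "fst x \<in> space ?L" by (simp add: space_pair_measure mem_Times_iff)
      then show "(case x of (u, s) \<Rightarrow> ?F u) = F (fst x)"
        unfolding case_prod_beta by (rule F_eq)
    qed
    then show ?thesis by simp
  qed
  have inner: "(\<integral>\<^sup>+s. ennreal (exp (- 1 / 2 * q u s) * g u * F u) \<partial>?L) = ennreal (C * reduced_density \<alpha> xs W root_weight z u)"
    if u: "u \<in> space ?L" for u
  proof -
    have qm: "(\<lambda>s. ennreal (exp (- 1 / 2 * q u s))) \<in> borel_measurable ?L"
      unfolding q_def by measurable
    have "(\<integral>\<^sup>+s. ennreal (exp (- 1 / 2 * q u s)) \<partial>?L) = (\<integral>\<^sup>+s. ennreal (exp (- 1 / 2 * q u (s(\<delta> := 0)))) \<partial>LV)"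
      using qm by (rule nn_integral_lebesgue_U)
    also have "\<dots> = (\<integral>\<^sup>+s. ennreal (exp (- 1 / 2 * (\<Sum>i\<in>set xs. \<Sum>j\<in>set xs. s i * A_mat Vt W u i j * s j))) \<partial>Pi\<^sub>M (set xs) (\<lambda>_. lborel))"
      unfolding q_def xs(2) by (intro nn_integral_cong) simp
    also have "\<dots> = ennreal (sqrt ((2 * pi) ^ length xs / pivot_prod xs (A_mat Vt W u)))"
      using A_pivots[where u = u, OF sp[OF u]] A_sym[where u = u, OF sp[OF u]] xs by (intro gaussian_integral) auto
    finally have gauss: "(\<integral>\<^sup>+s. ennreal (exp (- 1 / 2 * q u s)) \<partial>?L)
        = ennreal (sqrt ((2 * pi) ^ length xs / pivot_prod xs (A_mat Vt W u)))" .
    have nn: "g u * F u \<ge> 0" using g_nonneg[OF u] by (simp add: F_def)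
    have "(\<integral>\<^sup>+s. ennreal (exp (- 1 / 2 * q u s) * g u * F u) \<partial>?L)
        = (\<integral>\<^sup>+s. ennreal (g u * F u) * ennreal (exp (- 1 / 2 * q u s)) \<partial>?L)"
      unfolding ennreal_mult'[OF nn, symmetric] by (simp only: mult_ac)
    also have "\<dots> = ennreal (g u * F u * sqrt ((2 * pi) ^ length xs / pivot_prod xs (A_mat Vt W u)))"
      by (subst nn_integral_cmult[OF qm]) (simp only: gauss ennreal_mult'[OF nn])
    also have "g u * F u * sqrt ((2 * pi) ^ length xs / pivot_prod xs (A_mat Vt W u))
        = C * reduced_density \<alpha> xs W root_weight z u"
      unfolding g_def F_def C_def \<alpha>_def z_def by (rule density_after_s_integration[where u = u, OF sp[OF u] lV])
    finally show ?thesis .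
  qed
  have red_meas: "(\<lambda>u. ennreal (reduced_density \<alpha> xs W root_weight z u)) \<in> borel_measurable M"
    if "\<And>i. i \<in> V \<Longrightarrow> (\<lambda>u. u i) \<in> borel_measurable M" for M
    using that xs(2) by (intro measurable_compose[OF _ measurable_ennreal] reduced_density_measurable) auto
  have "(\<integral>\<^sup>+x. ennreal (case x of (u, s) \<Rightarrow> ?F u) \<partial>H22_measure Vt E W \<delta>)
      = (\<integral>\<^sup>+x. (case x of (u, s) \<Rightarrow> ennreal (H22_density Vt E W \<delta> u s)) * ennreal (case x of (u, s) \<Rightarrow> ?F u) \<partial>(?L \<Otimes>\<^sub>M ?L))"
    unfolding H22_measure_def using dens_meas F_meas by (intro nn_integral_density) simp_all
  also have "\<dots> = (\<integral>\<^sup>+x. ennreal (exp (- 1 / 2 * q (fst x) (snd x)) * g (fst x) * F (fst x)) \<partial>(?L \<Otimes>\<^sub>M ?L))"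
  proof (rule nn_integral_cong)
    fix x assume "x \<in> space (?L \<Otimes>\<^sub>M ?L)"
    then have x: "fst x \<in> space ?L" "snd x \<in> space ?L"
      by (simp_all add: space_pair_measure mem_Times_iff)
    show "(case x of (u, s) \<Rightarrow> ennreal (H22_density Vt E W \<delta> u s)) * ennreal (case x of (u, s) \<Rightarrow> ?F u)
        = ennreal (exp (- 1 / 2 * q (fst x) (snd x)) * g (fst x) * F (fst x))"
      unfolding case_prod_beta dens_eq[OF x] F_eq[OF x(1)]
      by (rule ennreal_mult'[symmetric]) (simp add: g_nonneg[OF x(1)])
  qed
  also have "\<dots> = (\<integral>\<^sup>+u. (\<integral>\<^sup>+s. ennreal (exp (- 1 / 2 * q u s) * g u * F u) \<partial>?L) \<partial>?L)"
    by (subst L.nn_integral_fst[symmetric]) simp_all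
  also have "\<dots> = (\<integral>\<^sup>+u. ennreal C * ennreal (reduced_density \<alpha> xs W root_weight z u) \<partial>?L)"
  proof -
    have "C \<ge> 0" by (simp add: C_def)
    show ?thesis
      unfolding ennreal_mult'[OF \<open>C \<ge> 0\<close>, symmetric] by (rule nn_integral_cong) (rule inner)
  qed
  also have "\<dots> = ennreal C * (\<integral>\<^sup>+u. ennreal (reduced_density \<alpha> xs W root_weight z u) \<partial>?L)"
    by (intro nn_integral_cmult red_meas) simp
  also have "(\<integral>\<^sup>+u. ennreal (reduced_density \<alpha> xs W root_weight z u) \<partial>?L)
      = (\<integral>\<^sup>+u. ennreal (reduced_density \<alpha> xs W root_weight z u) \<partial>Pi\<^sub>M (set xs) (\<lambda>_. lborel))"
    by (subst nn_integral_lebesgue_U[OF red_meas]) (simp_all add: reduced_density_extend xs(2))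
  also have "\<dots> = ennreal (sqrt (2 * pi) ^ length xs *
        exp (- (\<Sum>i\<in>set xs. \<Sum>j\<in>set xs. \<alpha> i * \<alpha> j * W i j) / 2 - (\<Sum>i\<in>set xs. \<alpha> i * z i)) /
        (\<Prod>i\<in>set xs. \<alpha> i))"
  proof (rule nn_integral_reduced_density[OF xs(1)])
    show "pinned (set xs) W root_weight" using pinned_V xs(2) by simp
    show "root_weight i \<le> z i" if "i \<in> set xs" for i using \<theta> that xs(2) by (simp add: z_def)
    show "\<alpha> i > 0" if "i \<in> set xs" for i
      using lV[of i] that unfolding xs(2) \<alpha>_def by simp
  qed
  also have "ennreal C * \<dots> = ennreal ?R"
  proof -
    have "C \<ge> 0" by (simp add: C_def)
    moreover have "C * (sqrt (2 * pi) ^ length xs *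
        exp (- (\<Sum>i\<in>V. \<Sum>j\<in>V. \<alpha> i * \<alpha> j * W i j) / 2 - (\<Sum>i\<in>V. \<alpha> i * z i)) /
        (\<Prod>i\<in>V. \<alpha> i)) = ?R"
      using laplace_constant[OF l, of \<theta>] by (simp add: C_def \<alpha>_def z_def)
    ultimately show ?thesis
      unfolding xs(2) by (simp only: ennreal_mult'[symmetric])
  qed
  finally have total: "(\<integral>\<^sup>+x. ennreal (case x of (u, s) \<Rightarrow> ?F u) \<partial>H22_measure Vt E W \<delta>) = ennreal ?R" .
  have "(\<integral>(u, s). ?F u \<partial>H22_measure Vt E W \<delta>) = enn2real (\<integral>\<^sup>+x. ennreal (case x of (u, s) \<Rightarrow> ?F u) \<partial>H22_measure Vt E W \<delta>)"
  proof (rule integral_eq_nn_integral)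
    show "(\<lambda>(u, s). ?F u) \<in> borel_measurable (H22_measure Vt E W \<delta>)"
      using F_meas by (simp add: H22_measure_def)
  qed auto
  also have "\<dots> = ?R"
  proof -
    have "sqrt (1 + l i) \<ge> 0" if "i \<in> V" for i
      using lV[OF that] by simp
    then have "?R \<ge> 0"
      unfolding laplace_constant[OF l, of \<theta>, symmetric]
      by (intro mult_nonneg_nonneg divide_nonneg_nonneg prod_nonneg ballI exp_ge_zero)
    then show ?thesis unfolding total by simp
  qed
  finally show ?thesis .
qed

end

theorem theorem2p1:
  fixes Vt :: "'v set" and E :: "'v set set" and W :: "'v \<Rightarrow> 'v \<Rightarrow> real"
    and \<delta> :: 'v and \<theta> l :: "'v \<Rightarrow> real"
  assumes "simple_graph Vt E" and "connected_graph Vt E" and "\<delta> \<in> Vt"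
    and "edge_weights Vt E W"
    and "\<forall>i\<in>Vt. \<theta> i \<le> 0" and "l \<in> Lambda_set Vt \<delta>"
  shows "(\<integral>(u, s).
            exp (inner_on Vt \<theta> (\<lambda>i. exp (u i))
                 - 1/2 * inner_on Vt \<theta> (mult_vec_on Vt (green Vt W \<delta> u) \<theta>)) *
            exp (- inner_on (Vt - {\<delta>}) l (beta Vt E W u))
          \<partial>H22_measure Vt E W \<delta>)
       = L_fun Vt E W \<delta> l * exp (inner_on Vt \<theta> (\<lambda>i. sqrt (1 + l i)))"
proof -
  interpret rooted_graph Vt E W \<delta>
    using assms by unfold_locales
  obtain xs where "distinct xs" "set xs = V"
    using finite_distinct_list[OF finite_V] by blast
  then interpret listed_rooted_graph Vt E W \<delta> xs
    by unfold_locales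
  show ?thesis
    using assms(5,6) by (rule laplace_transform)
qed

end
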